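(* If a structure $\mathcal{N}$ interprets a structure $\mathcal{M}$ then $\mathcal{N}$ trace defines $\mathcal{M}$. If a theory $T$ interprets a theory $T^*$ then $T$ trace defines $T^*$. Mutually interpretable structures or theories are trace equivalent.
   Context: Conventions: structures and theories are first order; theories are complete and consistent; "definable" means definable with parameters, and interpretations are allowed to use parameters. Two structures or theories are mutually interpretable if each interprets the other. $\mathcal{N}$ trace defines $\mathcal{M}$ if for some $n\ge 1$ there is a map $\tau\colon M\to N^n$ such that for every $m\ge 1$ and every $\mathcal{M}$-definable $X\subseteq M^m$ there is an $\mathcal{N}$-definable $Y\subseteq N^{mn}$ with $X=\{(a_1,\dots,a_m)\in M^m : (\tau(a_1),\dots,\tau(a_m))\in Y\}$. $T$ trace defines $\mathcal{M}$ if some model of $T$ does; $T$ trace defines $T^*$ if $T$ trace defines every model of $T^*$. Two theories are trace equivalent if each trace defines the other; two structures are trace equivalent if their theories are. *)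

theory Defs
  imports Main "HOL-Library.Equipollence"
begin

section \<open>First-order logic with equality\<close>

text \<open>
  Symbols come with their arity; constants are function symbols of arity 0. A language is a set of
  symbols rather than a type, so that either kind of symbol may be absent.
\<close>

record ('f, 'r) language =
  funs :: "('f \<times> nat) set"
  rels :: "('r \<times> nat) set"

datatype 'f trm = Var nat | Fn 'f "'f trm list"

datatype ('f, 'r) fm =
    Eq "'f trm" "'f trm"
  | Rel 'r "'f trm list"
  | Neg "('f, 'r) fm"
  | Conj "('f, 'r) fm" "('f, 'r) fm"
  | Ex nat "('f, 'r) fm"

primrec wf_trm :: "('f, 'r) language \<Rightarrow> 'f trm \<Rightarrow> bool" where
  "wf_trm L (Var x) \<longleftrightarrow> True"
| "wf_trm L (Fn f ts) \<longleftrightarrow> (f, length ts) \<in> funs L \<and> list_all (wf_trm L) ts"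

primrec wf_fm :: "('f, 'r) language \<Rightarrow> ('f, 'r) fm \<Rightarrow> bool" where
  "wf_fm L (Eq s t) \<longleftrightarrow> wf_trm L s \<and> wf_trm L t"
| "wf_fm L (Rel r ts) \<longleftrightarrow> (r, length ts) \<in> rels L \<and> list_all (wf_trm L) ts"
| "wf_fm L (Neg \<phi>) \<longleftrightarrow> wf_fm L \<phi>"
| "wf_fm L (Conj \<phi> \<psi>) \<longleftrightarrow> wf_fm L \<phi> \<and> wf_fm L \<psi>"
| "wf_fm L (Ex x \<phi>) \<longleftrightarrow> wf_fm L \<phi>"

primrec vars_trm :: "'f trm \<Rightarrow> nat set" where
  "vars_trm (Var x) = {x}"
| "vars_trm (Fn f ts) = \<Union> (set (map vars_trm ts))"

primrec free_vars :: "('f, 'r) fm \<Rightarrow> nat set" where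
  "free_vars (Eq s t) = vars_trm s \<union> vars_trm t"
| "free_vars (Rel r ts) = \<Union> (set (map vars_trm ts))"
| "free_vars (Neg \<phi>) = free_vars \<phi>"
| "free_vars (Conj \<phi> \<psi>) = free_vars \<phi> \<union> free_vars \<psi>"
| "free_vars (Ex x \<phi>) = free_vars \<phi> - {x}"

definition sentence :: "('f, 'r) language \<Rightarrow> ('f, 'r) fm \<Rightarrow> bool" where
  "sentence L \<phi> \<longleftrightarrow> wf_fm L \<phi> \<and> free_vars \<phi> = {}"

record ('f, 'r, 'a) fo_struct =
  slang :: "('f, 'r) language"
  carrier :: "'a set"
  fun_int :: "'f \<Rightarrow> 'a list \<Rightarrow> 'a"
  rel_int :: "'r \<Rightarrow> 'a list \<Rightarrow> bool"

definition is_structure :: "('f, 'r, 'a) fo_struct \<Rightarrow> bool" where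
  "is_structure M \<longleftrightarrow> carrier M \<noteq> {} \<and>
     (\<forall>(f, m) \<in> funs (slang M). \<forall>as. length as = m \<and> set as \<subseteq> carrier M \<longrightarrow>
        fun_int M f as \<in> carrier M)"

primrec eval_trm :: "('f, 'r, 'a) fo_struct \<Rightarrow> (nat \<Rightarrow> 'a) \<Rightarrow> 'f trm \<Rightarrow> 'a" where
  "eval_trm M e (Var x) = e x"
| "eval_trm M e (Fn f ts) = fun_int M f (map (eval_trm M e) ts)"

primrec sat :: "('f, 'r, 'a) fo_struct \<Rightarrow> (nat \<Rightarrow> 'a) \<Rightarrow> ('f, 'r) fm \<Rightarrow> bool" where
  "sat M e (Eq s t) \<longleftrightarrow> eval_trm M e s = eval_trm M e t"
| "sat M e (Rel r ts) \<longleftrightarrow> rel_int M r (map (eval_trm M e) ts)"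
| "sat M e (Neg \<phi>) \<longleftrightarrow> \<not> sat M e \<phi>"
| "sat M e (Conj \<phi> \<psi>) \<longleftrightarrow> sat M e \<phi> \<and> sat M e \<psi>"
| "sat M e (Ex x \<phi>) \<longleftrightarrow> (\<exists>a \<in> carrier M. sat M (e(x := a)) \<phi>)"

definition holds :: "('f, 'r, 'a) fo_struct \<Rightarrow> ('f, 'r) fm \<Rightarrow> bool" where
  "holds M \<phi> \<longleftrightarrow> (\<forall>e. range e \<subseteq> carrier M \<longrightarrow> sat M e \<phi>)"


section \<open>Definability, interpretations and trace definability for structures\<close>

text \<open>Elements of a power of the carrier are lists of the appropriate length.\<close>

definition tuples :: "('f, 'r, 'a) fo_struct \<Rightarrow> nat \<Rightarrow> 'a list set" where
  "tuples M m = {as. length as = m \<and> set as \<subseteq> carrier M}"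

text \<open>
  Variables \<open>0, \<dots>, m - 1\<close> of the defining formula stand for the coordinates of the tuple;
  the finitely many other free variables hold the parameters, given by \<open>e\<close>.
\<close>

definition definable :: "('f, 'r, 'a) fo_struct \<Rightarrow> nat \<Rightarrow> 'a list set \<Rightarrow> bool" where
  "definable M m X \<longleftrightarrow> (\<exists>\<phi> e. wf_fm (slang M) \<phi> \<and> range e \<subseteq> carrier M \<and>
     X = {as \<in> tuples M m. sat M (\<lambda>i. if i < m then as ! i else e i) \<phi>})"

text \<open>
  For \<open>\<pi> : D \<rightarrow> M\<close> with \<open>D\<close> a set of \<open>k\<close>-tuples, the preimage of a set of \<open>m\<close>-tuples of \<open>M\<close>, as a
  set of \<open>(m * k)\<close>-tuples.
\<close>

definition pullback :: "('b list \<Rightarrow> 'a) \<Rightarrow> 'b list set \<Rightarrow> nat \<Rightarrow> 'a list set \<Rightarrow> 'b list set" where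
  "pullback \<pi> D m X = {concat bs | bs. length bs = m \<and> set bs \<subseteq> D \<and> map \<pi> bs \<in> X}"

text \<open>
  A (many-dimensional) interpretation with parameters, as in Hodges: a surjection from a definable
  set of \<open>k\<close>-tuples onto the interpreted structure, under which the preimages of equality, of the
  basic relations and of the graphs of the basic functions are definable.
\<close>

definition interprets :: "('f, 'r, 'a) fo_struct \<Rightarrow> ('g, 's, 'b) fo_struct \<Rightarrow> bool" where
  "interprets N M \<longleftrightarrow> (\<exists>k \<ge> 1. \<exists>D \<pi>.
     definable N k D \<and> \<pi> ` D = carrier M \<and>
     definable N (2 * k) (pullback \<pi> D 2 {[a, a] | a. a \<in> carrier M}) \<and>
     (\<forall>(r, m) \<in> rels (slang M).
        definable N (m * k) (pullback \<pi> D m {as \<in> tuples M m. rel_int M r as})) \<and>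
     (\<forall>(f, m) \<in> funs (slang M).
        definable N ((m + 1) * k)
          (pullback \<pi> D (m + 1) {as @ [fun_int M f as] | as. as \<in> tuples M m})))"

definition trace_defines :: "('f, 'r, 'a) fo_struct \<Rightarrow> ('g, 's, 'b) fo_struct \<Rightarrow> bool" where
  "trace_defines N M \<longleftrightarrow> (\<exists>n \<ge> 1. \<exists>\<tau>. \<tau> ` carrier M \<subseteq> tuples N n \<and>
     (\<forall>m \<ge> 1. \<forall>X. definable M m X \<longrightarrow>
        (\<exists>Y. definable N (m * n) Y \<and> X = {as \<in> tuples M m. concat (map \<tau> as) \<in> Y})))"

definition mutually_interpretable ::
    "('f, 'r, 'a) fo_struct \<Rightarrow> ('g, 's, 'b) fo_struct \<Rightarrow> bool" where
  "mutually_interpretable N M \<longleftrightarrow> interprets N M \<and> interprets M N"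


section \<open>Theories\<close>

record ('f, 'r) fo_theory =
  tlang :: "('f, 'r) language"
  axioms :: "('f, 'r) fm set"

definition is_model :: "('f, 'r, 'a) fo_struct \<Rightarrow> ('f, 'r) fo_theory \<Rightarrow> bool" where
  "is_model M T \<longleftrightarrow> is_structure M \<and> slang M = tlang T \<and> (\<forall>\<phi> \<in> axioms T. holds M \<phi>)"

definition Th :: "('f, 'r, 'a) fo_struct \<Rightarrow> ('f, 'r) fo_theory" where
  "Th M = \<lparr>tlang = slang M, axioms = {\<phi>. sentence (slang M) \<phi> \<and> holds M \<phi>}\<rparr>"

text \<open>
  HOL cannot quantify over types inside a formula, so \<open>some model\<close> and \<open>every model\<close> of a theory
  refer to models whose carrier is a subset of a type \<open>'u\<close>, the universe, which is passed
  explicitly where it cannot be read off from the arguments. The universe is arbitrary except that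
  it is infinite and at least as large as the languages involved. By the Loewenheim-Skolem theorems
  such a universe is large enough for the notions below: it realises every complete theory in such
  a language, and if any model of \<open>T\<close> whatsoever trace defines a structure with carrier in \<open>'u\<close>,
  then so does a model of \<open>T\<close> with carrier in \<open>'u\<close>.
\<close>

definition adequate_universe :: "'u itself \<Rightarrow> ('f, 'r) language \<Rightarrow> bool" where
  "adequate_universe _ L \<longleftrightarrow>
     infinite (UNIV :: 'u set) \<and> funs L \<lesssim> (UNIV :: 'u set) \<and> rels L \<lesssim> (UNIV :: 'u set)"

text \<open>
  Consistency and completeness in semantic form; theories need not be deductively closed.
\<close>

definition complete_consistent :: "'u itself \<Rightarrow> ('f, 'r) fo_theory \<Rightarrow> bool" where
  "complete_consistent _ T \<longleftrightarrow>
     (\<forall>\<phi> \<in> axioms T. sentence (tlang T) \<phi>) \<and>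
     (\<exists>M :: ('f, 'r, 'u) fo_struct. is_model M T) \<and>
     (\<forall>\<phi>. sentence (tlang T) \<phi> \<longrightarrow>
        (\<forall>M :: ('f, 'r, 'u) fo_struct. is_model M T \<longrightarrow> holds M \<phi>) \<or>
        (\<forall>M :: ('f, 'r, 'u) fo_struct. is_model M T \<longrightarrow> holds M (Neg \<phi>)))"

text \<open>
  Requiring only some model of \<open>T\<close> to interpret some model of \<open>T'\<close> makes this the weakest of the
  usual notions of interpretation between complete theories, parameters being allowed.
\<close>

definition theory_interprets ::
    "'u itself \<Rightarrow> ('f, 'r) fo_theory \<Rightarrow> ('g, 's) fo_theory \<Rightarrow> bool" where
  "theory_interprets _ T T' \<longleftrightarrow>
     (\<exists>(N :: ('f, 'r, 'u) fo_struct) (M :: ('g, 's, 'u) fo_struct).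
        is_model N T \<and> is_model M T' \<and> interprets N M)"

definition theory_trace_defines_struct ::
    "('f, 'r) fo_theory \<Rightarrow> ('g, 's, 'u) fo_struct \<Rightarrow> bool" where
  "theory_trace_defines_struct T M \<longleftrightarrow>
     (\<exists>N :: ('f, 'r, 'u) fo_struct. is_model N T \<and> trace_defines N M)"

definition theory_trace_defines ::
    "'u itself \<Rightarrow> ('f, 'r) fo_theory \<Rightarrow> ('g, 's) fo_theory \<Rightarrow> bool" where
  "theory_trace_defines _ T T' \<longleftrightarrow>
     (\<forall>M :: ('g, 's, 'u) fo_struct. is_model M T' \<longrightarrow> theory_trace_defines_struct T M)"

definition mutually_interpretable_theories ::
    "'u itself \<Rightarrow> ('f, 'r) fo_theory \<Rightarrow> ('g, 's) fo_theory \<Rightarrow> bool" where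
  "mutually_interpretable_theories U T T' \<longleftrightarrow>
     theory_interprets U T T' \<and> theory_interprets U T' T"

definition trace_equivalent_theories ::
    "'u itself \<Rightarrow> ('f, 'r) fo_theory \<Rightarrow> ('g, 's) fo_theory \<Rightarrow> bool" where
  "trace_equivalent_theories U T T' \<longleftrightarrow>
     theory_trace_defines U T T' \<and> theory_trace_defines U T' T"

definition trace_equivalent ::
    "'u itself \<Rightarrow> ('f, 'r, 'a) fo_struct \<Rightarrow> ('g, 's, 'b) fo_struct \<Rightarrow> bool" where
  "trace_equivalent U N M \<longleftrightarrow> trace_equivalent_theories U (Th N) (Th M)"

end

theory Submission
  imports Defs "HOL-Library.Omega_Words_Fun"
begin

text \<open>
  If \<open>\<pi> : D \<rightarrow> M\<close> is an interpretation of \<open>M\<close> in \<open>N\<close>, the preimages of definable sets under \<open>\<pi>\<close> are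
  definable, by induction on formulas; hence any section \<open>\<tau>\<close> of \<open>\<pi>\<close> witnesses trace definability.

  For theories, trace definability has to be carried from \<open>M\<close> to an elementarily equivalent \<open>M'\<close>.
  Take the set of maps \<open>g : M' \<rightarrow> M\<close> as index set. By elementary equivalence, the sets
  \<open>{g. M \<Turnstile> \<phi>[g \<circ> e]}\<close>, for \<open>M' \<Turnstile> \<phi>[e]\<close>, are nonempty and closed under intersection, so they lie in
  an ultrafilter. In the ultrapower of \<open>N\<close>, the map sending \<open>a\<close> to the class of \<open>g \<mapsto> \<tau> (g a)\<close>
  witnesses that \<open>M'\<close> is trace definable, by the theorem of Los. A Skolem hull inside the ultrapower
  keeps the cardinality within that of the universe, and only the parameters of the translated
  formulas have to be put into this hull, so \<open>N\<close> itself may be larger than the universe.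
\<close>

section \<open>Cardinality of the set of formulas\<close>

lemma lepoll_iff_card_of: "A \<lesssim> B \<longleftrightarrow> (card_of A, card_of B) \<in> ordLeq"
  by (simp add: lepoll_def card_of_ordLeq)

lemma UN_lepoll_infinite:
  assumes "infinite K" "I \<lesssim> K" "\<And>i. i \<in> I \<Longrightarrow> A i \<lesssim> K"
  shows "(\<Union>i\<in>I. A i) \<lesssim> K"
  using assms card_of_UNION_ordLeq_infinite[of K I A] by (simp add: lepoll_iff_card_of)

lemma Un_lepoll_infinite:
  assumes "infinite K" "A \<lesssim> K" "B \<lesssim> K"
  shows "A \<union> B \<lesssim> K"
  using UN_lepoll_infinite[of K "{True, False}" "\<lambda>b. if b then A else B"] assms
  by (simp add: finite_lepoll_infinite Un_commute)

lemma Times_lepoll_infinite: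
  assumes "infinite K" "A \<lesssim> K" "B \<lesssim> K"
  shows "A \<times> B \<lesssim> K"
proof -
  have "A \<times> B \<lesssim> K \<times> K" using assms by (intro times_lepoll_mono)
  also have "K \<times> K \<lesssim> K"
    using card_of_Times_same_infinite[OF assms(1)] by (simp add: lepoll_iff_card_of ordIso_iff_ordLeq)
  finally show ?thesis .
qed

lemma nat_lepoll_infinite:
  assumes "infinite K"
  shows "(S :: nat set) \<lesssim> K"
proof -
  have "S \<lesssim> (UNIV :: nat set)" by (simp add: subset_imp_lepoll)
  also have "(UNIV :: nat set) \<lesssim> K" using assms by (simp add: infinite_le_lepoll)
  finally show ?thesis .
qed

lemma lists_lepoll_infinite:
  assumes K: "infinite K" and A: "A \<lesssim> K"
  shows "lists A \<lesssim> K"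
proof -
  have "{xs \<in> lists A. length xs = n} \<lesssim> K" for n
  proof (induction n)
    case 0
    have "finite {xs \<in> lists A. length xs = 0}"
      by (rule finite_subset[of _ "{[]}"]) auto
    then show ?case using K by (rule finite_lepoll_infinite[rotated])
  next
    case (Suc n)
    have "{xs \<in> lists A. length xs = Suc n} \<subseteq>
        (\<lambda>(x, xs). x # xs) ` (A \<times> {xs \<in> lists A. length xs = n})"
      by (force simp: length_Suc_conv)
    then have "{xs \<in> lists A. length xs = Suc n} \<lesssim> A \<times> {xs \<in> lists A. length xs = n}"
      by (rule subset_image_lepoll)
    also have "\<dots> \<lesssim> K" by (rule Times_lepoll_infinite[OF K A Suc.IH])
    finally show ?case .
  qed
  then have "(\<Union>n. {xs \<in> lists A. length xs = n}) \<lesssim> K"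
    by (intro UN_lepoll_infinite[OF K]) (auto intro: nat_lepoll_infinite[OF K])
  also have "(\<Union>n. {xs \<in> lists A. length xs = n}) = lists A" by auto
  finally show ?thesis .
qed

text \<open>Operations act on lists of any length, so one closure serves for terms, formulas and
  Skolem hulls alike.\<close>

inductive_set fin_closure :: "'x set \<Rightarrow> ('x list \<Rightarrow> 'x) set \<Rightarrow> 'x set"
  for B Ops where
  base: "b \<in> B \<Longrightarrow> b \<in> fin_closure B Ops"
| step: "op \<in> Ops \<Longrightarrow> (\<And>x. x \<in> set xs \<Longrightarrow> x \<in> fin_closure B Ops) \<Longrightarrow> op xs \<in> fin_closure B Ops"

text \<open>The closure is exhausted by countably many stages \<open>F n\<close>, and no stage
  exceeds \<open>K\<close>, since passing to finite lists does not lead beyond an infinite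
  bound.\<close>

lemma fin_closure_lepoll:
  assumes K: "infinite K" and B: "B \<lesssim> K" and Ops: "Ops \<lesssim> K"
  shows "fin_closure B Ops \<lesssim> K"
proof -
  define F where "F n = ((\<lambda>S. S \<union> (\<lambda>(op, xs). op xs) ` (Ops \<times> lists S)) ^^ n) B" for n
  have F_Suc: "F (Suc n) = F n \<union> (\<lambda>(op, xs). op xs) ` (Ops \<times> lists (F n))" for n
    by (simp add: F_def)
  have "F n \<lesssim> K" for n
  proof (induction n)
    case 0
    then show ?case by (simp add: F_def B)
  next
    case (Suc n)
    have "Ops \<times> lists (F n) \<lesssim> K"
      by (intro Times_lepoll_infinite lists_lepoll_infinite K Ops Suc.IH)
    then show ?case
      unfolding F_Suc by (intro Un_lepoll_infinite K Suc.IH lepoll_trans[OF image_lepoll])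
  qed
  then have UN: "(\<Union>n. F n) \<lesssim> K"
    by (intro UN_lepoll_infinite[OF K]) (auto intro: nat_lepoll_infinite[OF K])
  have mono: "F m \<subseteq> F n" if "m \<le> n" for m n
    using that by (induction rule: dec_induct) (auto simp: F_Suc)
  have "x \<in> (\<Union>n. F n)" if "x \<in> fin_closure B Ops" for x
    using that
  proof induction
    case (base b)
    then have "b \<in> F 0" by (simp add: F_def)
    then show ?case by blast
  next
    case (step op xs)
    then obtain n where n: "\<And>x. x \<in> set xs \<Longrightarrow> x \<in> F (n x)" by (metis UN_E)
    \<comment> \<open>The entries of a finite list appear at finitely many stages; the stages
      increase, so the last of these contains the whole list.\<close>
    have "x \<in> F (Max (n ` set xs))" if "x \<in> set xs" for x
      using n[OF that] mono[of "n x" "Max (n ` set xs)"] that by auto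
    then have "op xs \<in> F (Suc (Max (n ` set xs)))"
      unfolding F_Suc using step.hyps(1) by force
    then show ?case by blast
  qed
  then have "fin_closure B Ops \<subseteq> (\<Union>n. F n)" by blast
  then show ?thesis using UN by (meson lepoll_trans subset_imp_lepoll)
qed

text \<open>Arities are forgotten: the closure also contains ill-formed terms, but an upper bound
  asks only for the inclusion.\<close>

lemma wf_trm_lepoll:
  assumes K: "infinite K" and "funs L \<lesssim> K"
  shows "{t. wf_trm L t} \<lesssim> K"
proof -
  have "t \<in> fin_closure (range Var) ((\<lambda>(f, n). Fn f) ` funs L)" if "wf_trm L t" for t
    using that
  proof (induction t)
    case (Var x)
    then show ?case by (auto intro: fin_closure.base)
  next
    case (Fn f ts)
    then have "(\<lambda>ts. Fn f ts) \<in> (\<lambda>(f, n). Fn f) ` funs L" by force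
    moreover have "s \<in> fin_closure (range Var) ((\<lambda>(f, n). Fn f) ` funs L)" if "s \<in> set ts" for s
      using Fn that by (simp add: list_all_iff)
    ultimately show ?case by (rule fin_closure.step)
  qed
  then have "{t. wf_trm L t} \<subseteq> fin_closure (range Var) ((\<lambda>(f, n). Fn f) ` funs L)" by blast
  then have "{t. wf_trm L t} \<lesssim> fin_closure (range Var) ((\<lambda>(f, n). Fn f) ` funs L)"
    by (rule subset_imp_lepoll)
  also have "\<dots> \<lesssim> K"
    by (intro fin_closure_lepoll lepoll_trans[OF image_lepoll] nat_lepoll_infinite assms)
  finally show ?thesis .
qed

lemma wf_fm_lepoll:
  fixes L :: "('f, 'r) language"
  assumes K: "infinite K" and "funs L \<lesssim> K" "rels L \<lesssim> K"
  shows "{\<phi> :: ('f, 'r) fm. wf_fm L \<phi>} \<lesssim> K"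
proof -
  let ?T = "{t. wf_trm L t}"
  define B where "B = (\<lambda>(s, t). Eq s t) ` (?T \<times> ?T) \<union> (\<lambda>((r, n), ts). Rel r ts) ` (rels L \<times> lists ?T)"
  \<comment> \<open>Connectives and quantifiers become list operations that read the first one or
    two entries; arbitrary results on shorter lists only enlarge the closure.\<close>
  define Ops where "Ops = {\<lambda>\<phi>s. Neg (\<phi>s ! 0), \<lambda>\<phi>s. Conj (\<phi>s ! 0) (\<phi>s ! 1)} \<union>
    range (\<lambda>x \<phi>s :: ('f, 'r) fm list. Ex x (\<phi>s ! 0))"
  have T: "?T \<lesssim> K" using wf_trm_lepoll assms by blast
  have "B \<lesssim> K" unfolding B_def
    by (intro Un_lepoll_infinite[OF K] lepoll_trans[OF image_lepoll] Times_lepoll_infinite[OF K]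
        lists_lepoll_infinite[OF K] assms T)
  moreover have "Ops \<lesssim> K" unfolding Ops_def
    by (intro Un_lepoll_infinite[OF K] lepoll_trans[OF image_lepoll] nat_lepoll_infinite[OF K]
        finite_lepoll_infinite[OF K]) auto
  ultimately have "fin_closure B Ops \<lesssim> K" by (rule fin_closure_lepoll[OF K])
  moreover have "{\<phi>. wf_fm L \<phi>} \<lesssim> fin_closure B Ops"
  proof (intro subset_imp_lepoll subsetI, unfold mem_Collect_eq)
    fix \<phi> assume "wf_fm L \<phi>"
    then show "\<phi> \<in> fin_closure B Ops"
    proof (induction \<phi>)
      case (Eq s t)
      then have "Eq s t \<in> (\<lambda>(s, t). Eq s t) ` (?T \<times> ?T)" by (auto intro!: image_eqI[where x = "(s, t)"])
      then show ?case unfolding B_def by (intro fin_closure.base UnI1)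
    next
      case (Rel r ts)
      then have "ts \<in> lists ?T" by (auto simp: list_all_iff)
      with Rel have "Rel r ts \<in> (\<lambda>((r, n), ts). Rel r ts) ` (rels L \<times> lists ?T)"
        by (intro image_eqI[where x = "((r, length ts), ts)"]) auto
      then show ?case unfolding B_def by (intro fin_closure.base UnI2)
    next
      case (Neg \<phi>)
      have "(\<lambda>\<phi>s. Neg (\<phi>s ! 0)) \<in> Ops" by (simp add: Ops_def)
      from fin_closure.step[OF this, of "[\<phi>]" B] Neg show ?case by auto
    next
      case (Conj \<phi> \<psi>)
      have "(\<lambda>\<phi>s. Conj (\<phi>s ! 0) (\<phi>s ! 1)) \<in> Ops" by (simp add: Ops_def)
      from fin_closure.step[OF this, of "[\<phi>, \<psi>]" B] Conj show ?case by auto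
    next
      case (Ex x \<phi>)
      have "(\<lambda>\<phi>s. Ex x (\<phi>s ! 0)) \<in> Ops" by (simp add: Ops_def)
      from fin_closure.step[OF this, of "[\<phi>]" B] Ex show ?case by auto
    qed
  qed
  ultimately show ?thesis by (rule lepoll_trans[rotated])
qed

section \<open>Renaming of variables\<close>

lemma eval_trm_cong:
  assumes "\<And>x. x \<in> vars_trm t \<Longrightarrow> e x = e' x"
  shows "eval_trm M e t = eval_trm M e' t"
  using assms
proof (induction t)
  case (Fn f ts)
  then have "map (eval_trm M e) ts = map (eval_trm M e') ts"
    by (intro map_cong[OF refl]) auto
  then show ?case by (metis eval_trm.simps(2))
qed simp

lemma sat_cong:
  assumes "\<And>x. x \<in> free_vars \<phi> \<Longrightarrow> e x = e' x"
  shows "sat M e \<phi> \<longleftrightarrow> sat M e' \<phi>"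
  using assms
proof (induction \<phi> arbitrary: e e')
  case (Eq s t)
  then show ?case using eval_trm_cong[of s e e' M] eval_trm_cong[of t e e' M] by simp
next
  case (Rel r ts)
  then have "map (eval_trm M e) ts = map (eval_trm M e') ts"
    by (auto intro!: eval_trm_cong)
  then show ?case by (metis sat.simps(2))
next
  case (Neg \<phi>)
  then show ?case by (metis free_vars.simps(3) sat.simps(3))
next
  case (Conj \<phi> \<psi>)
  have "sat M e \<phi> = sat M e' \<phi>" "sat M e \<psi> = sat M e' \<psi>"
    using Conj.prems by (intro Conj.IH; simp)+
  then show ?case by simp
next
  case (Ex x \<phi>)
  have "sat M (e(x := a)) \<phi> = sat M (e'(x := a)) \<phi>" for a
    using Ex.prems by (intro Ex.IH) auto
  then show ?case by simp
qed

lemma finite_vars_trm: "finite (vars_trm t)"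
  by (induction t) auto

lemma finite_free_vars: "finite (free_vars \<phi>)"
  by (induction \<phi>) (auto simp: finite_vars_trm)

lemma free_vars_bound: "\<exists>K. \<forall>x\<in>free_vars \<phi>. x < K"
  by (meson finite_free_vars finite_nat_set_iff_bounded)

primrec rename_trm :: "(nat \<Rightarrow> nat) \<Rightarrow> 'f trm \<Rightarrow> 'f trm" where
  "rename_trm \<sigma> (Var x) = Var (\<sigma> x)"
| "rename_trm \<sigma> (Fn f ts) = Fn f (map (rename_trm \<sigma>) ts)"

text \<open>\<open>\<sigma>\<close> is an argument of the resulting function because it changes
  under a quantifier; the new bound variable lies outside the image of the free variables, which
  prevents capture.\<close>

primrec rename :: "('f, 'r) fm \<Rightarrow> (nat \<Rightarrow> nat) \<Rightarrow> ('f, 'r) fm" where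
  "rename (Eq s t) = (\<lambda>\<sigma>. Eq (rename_trm \<sigma> s) (rename_trm \<sigma> t))"
| "rename (Rel r ts) = (\<lambda>\<sigma>. Rel r (map (rename_trm \<sigma>) ts))"
| "rename (Neg \<phi>) = (\<lambda>\<sigma>. Neg (rename \<phi> \<sigma>))"
| "rename (Conj \<phi> \<psi>) = (\<lambda>\<sigma>. Conj (rename \<phi> \<sigma>) (rename \<psi> \<sigma>))"
| "rename (Ex x \<phi>) = (\<lambda>\<sigma>. let z = (SOME z. z \<notin> \<sigma> ` free_vars \<phi>) in Ex z (rename \<phi> (\<sigma>(x := z))))"

lemma wf_rename_trm: "wf_trm L t \<Longrightarrow> wf_trm L (rename_trm \<sigma> t)"
  by (induction t) (auto simp: list_all_iff)

lemma wf_rename [simp]: "wf_fm L \<phi> \<Longrightarrow> wf_fm L (rename \<phi> \<sigma>)"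
  by (induction \<phi> arbitrary: \<sigma>) (auto simp: list_all_iff wf_rename_trm Let_def)

lemma eval_rename_trm: "eval_trm M e (rename_trm \<sigma> t) = eval_trm M (e \<circ> \<sigma>) t"
  by (induction t) (auto intro!: arg_cong[where f = "fun_int M _"])

lemma sat_rename [simp]: "sat M e (rename \<phi> \<sigma>) \<longleftrightarrow> sat M (e \<circ> \<sigma>) \<phi>"
proof (induction \<phi> arbitrary: e \<sigma>)
  case (Ex x \<phi>)
  define z where "z = (SOME z. z \<notin> \<sigma> ` free_vars \<phi>)"
  have z: "z \<notin> \<sigma> ` free_vars \<phi>"
    unfolding z_def by (rule someI_ex) (simp add: ex_new_if_finite finite_free_vars)
  \<comment> \<open>At a free variable \<open>y\<close> other than \<open>x\<close>,
    \<open>\<sigma> y\<close> differs from \<open>z\<close>, so the update at \<open>z\<close> is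
    not seen there.\<close>
  have "sat M (e(z := a) \<circ> \<sigma>(x := z)) \<phi> \<longleftrightarrow> sat M ((e \<circ> \<sigma>)(x := a)) \<phi>" for a
    using z by (intro sat_cong) auto
  then show ?case unfolding rename.simps Let_def z_def[symmetric] sat.simps Ex.IH by simp
qed (simp_all add: eval_rename_trm comp_def)

section \<open>Definable predicates on assignments\<close>

text \<open>The closure properties that an induction on formulas consumes. The instance for
  \<open>definable_pred\<close> serves to build the one for predicates pulled back along an
  interpretation, to which \<open>sat_in_family\<close> is applied.\<close>

locale predicate_family =
  fixes C :: "'a set" and Q :: "((nat \<Rightarrow> 'a) \<Rightarrow> bool) \<Rightarrow> bool"
  assumes cong: "Q P \<Longrightarrow> (\<And>e. range e \<subseteq> C \<Longrightarrow> P e \<longleftrightarrow> P' e) \<Longrightarrow> Q P'"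
    and top: "Q (\<lambda>e. True)"
    and neg: "Q P \<Longrightarrow> Q (\<lambda>e. \<not> P e)"
    and conj: "Q P \<Longrightarrow> Q P' \<Longrightarrow> Q (\<lambda>e. P e \<and> P' e)"
    and ex: "Q P \<Longrightarrow> Q (\<lambda>e. \<exists>a\<in>C. P ([a] \<frown> e))"
    and subst: "Q P \<Longrightarrow> Q (\<lambda>e. P (e \<circ> \<sigma>))"
begin

lemma all_less: "(\<And>i. i < (n::nat) \<Longrightarrow> Q (P i)) \<Longrightarrow> Q (\<lambda>e. \<forall>i<n. P i e)"
proof (induction n)
  case 0
  then show ?case using top by simp
next
  case (Suc n)
  then have "Q (\<lambda>e. (\<forall>i<n. P i e) \<and> P n e)" by (intro conj) auto
  then show ?case by (rule cong) (auto simp: less_Suc_eq)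
qed

lemma ex_list: "Q P \<Longrightarrow> Q (\<lambda>e. \<exists>as. length as = n \<and> set as \<subseteq> C \<and> P (as \<frown> e))"
proof (induction n arbitrary: P)
  case 0
  then show ?case by simp
next
  case (Suc n)
  have "Q (\<lambda>e. \<exists>as. length as = n \<and> set as \<subseteq> C \<and> (\<exists>a\<in>C. P ([a] \<frown> (as \<frown> e))))"
    by (rule Suc.IH[OF ex[OF Suc.prems]])
  then show ?case
    by (rule cong) (fastforce simp: length_Suc_conv)
qed

lemma eval_list:
  assumes "\<And>t. t \<in> set ts \<Longrightarrow> Q (\<lambda>e. e 0 = eval_trm M (e \<circ> Suc) t)"
  shows "Q (\<lambda>e. \<forall>i<length ts. e i = eval_trm M (\<lambda>x. e (x + k)) (ts ! i))"
proof (rule all_less)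
  fix i assume "i < length ts"
  then have "Q (\<lambda>e. e 0 = eval_trm M (e \<circ> Suc) (ts ! i))" using assms by simp
  \<comment> \<open>The substitution sends the value variable 0 to \<open>i\<close> and variable
    \<open>x + 1\<close> to \<open>x + k\<close>.\<close>
  from subst[OF this, of "case_nat i (\<lambda>x. x + k)"]
  show "Q (\<lambda>e. e i = eval_trm M (\<lambda>x. e (x + k)) (ts ! i))" by (simp add: comp_def)
qed

lemma eval_list_unique:
  fixes M :: "('f, 'r, 'a) fo_struct"
  assumes "length as = length ts"
  shows "(\<forall>i<length ts. (as \<frown> e) i = eval_trm M e' (ts ! i)) \<longleftrightarrow> as = map (eval_trm M e') ts"
proof
  assume "\<forall>i<length ts. (as \<frown> e) i = eval_trm M e' (ts ! i)"
  then show "as = map (eval_trm M e') ts" using assms by (intro nth_equalityI) simp_all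
qed simp

end

lemma fun_int_in_carrier:
  assumes "is_structure M" "(f, length as) \<in> funs (slang M)" "set as \<subseteq> carrier M"
  shows "fun_int M f as \<in> carrier M"
proof -
  have "\<forall>(f, m) \<in> funs (slang M). \<forall>as. length as = m \<and> set as \<subseteq> carrier M \<longrightarrow>
      fun_int M f as \<in> carrier M"
    using assms(1) unfolding is_structure_def by (rule conjunct2)
  from bspec[OF this assms(2)] show ?thesis using assms(3) by simp
qed

lemma eval_trm_in_carrier:
  assumes "is_structure M" "range e \<subseteq> carrier M" "wf_trm (slang M) t"
  shows "eval_trm M e t \<in> carrier M"
  using assms(3)
proof (induction t)
  case (Fn f ts)
  then have "set (map (eval_trm M e) ts) \<subseteq> carrier M" by (auto simp: list_all_iff)
  moreover have "(f, length (map (eval_trm M e) ts)) \<in> funs (slang M)" using Fn by simp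
  ultimately show ?case
    using fun_int_in_carrier[OF assms(1)] by (simp del: set_map length_map)
next
  case (Var x)
  then show ?case using assms(2) by auto
qed

text \<open>Induction on formulas with terms unnested: an interpretation supplies only the graphs of
  basic functions, so the values of arguments are introduced by existential quantifiers.\<close>

lemma (in predicate_family) sat_in_family:
  fixes M :: "('f, 'r, 'a) fo_struct"
  assumes M: "is_structure M" and C: "carrier M = C"
    and eq: "Q (\<lambda>e. e 0 = e 1)"
    and rel: "\<And>r m. (r, m) \<in> rels (slang M) \<Longrightarrow> Q (\<lambda>e. rel_int M r (map e [0..<m]))"
    and fn: "\<And>f m. (f, m) \<in> funs (slang M) \<Longrightarrow> Q (\<lambda>e. e m = fun_int M f (map e [0..<m]))"
    and "wf_fm (slang M) \<phi>"
  shows "Q (\<lambda>e. sat M e \<phi>)"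
proof -
  have map_conc: "map (as \<frown> e) [0..<length as] = as" for as :: "'a list" and e
    by (rule nth_equalityI) simp_all
  have eval_carrier: "set (map (eval_trm M e) ts) \<subseteq> C"
    if "range e \<subseteq> C" "list_all (wf_trm (slang M)) ts" for e ts
    using that eval_trm_in_carrier[OF M] by (auto simp: list_all_iff C)
  \<comment> \<open>The values of the arguments are uniquely determined, so the quantifier over them
    collapses to the actual list of values.\<close>
  have one_point: "(\<exists>as. length as = n \<and> set as \<subseteq> C \<and> R as) \<longleftrightarrow> S"
    if "\<And>as. length as = n \<Longrightarrow> R as \<longleftrightarrow> as = xs \<and> S" "length xs = n" "set xs \<subseteq> C"
    for n xs R S
    using that by metis
  have trm: "Q (\<lambda>e. e 0 = eval_trm M (e \<circ> Suc) t)" if "wf_trm (slang M) t" for t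
    using that
  proof (induction t)
    case (Var x)
    from subst[OF eq, of "\<lambda>i. if i = 0 then 0 else Suc x"] show ?case by simp
  next
    case (Fn f ts)
    let ?n = "length ts"
    have ts: "list_all (wf_trm (slang M)) ts" and f: "(f, ?n) \<in> funs (slang M)"
      using Fn.prems by auto
    \<comment> \<open>Three zones: below \<open>?n\<close> the values of the arguments, at
      \<open>?n\<close> the value of the whole term (the former variable 0), from
      \<open>Suc ?n\<close> on the assignment.\<close>
    have "Q (\<lambda>e. \<forall>i<?n. e i = eval_trm M (\<lambda>x. e (x + Suc ?n)) (ts ! i))"
      using Fn.IH ts unfolding list_all_iff by (intro eval_list) blast
    from ex_list[OF conj[OF this fn[OF f]], of ?n]
    show ?case
    proof (rule cong)
      fix e :: "nat \<Rightarrow> 'a" assume e: "range e \<subseteq> C"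
      then have e': "range (e \<circ> Suc) \<subseteq> C" by auto
      let ?R = "\<lambda>as. (\<forall>i<?n. (as \<frown> e) i = eval_trm M (\<lambda>x. (as \<frown> e) (x + Suc ?n)) (ts ! i)) \<and>
         (as \<frown> e) ?n = fun_int M f (map (as \<frown> e) [0..<?n])"
      have "?R as \<longleftrightarrow> as = map (eval_trm M (e \<circ> Suc)) ts \<and> e 0 = eval_trm M (e \<circ> Suc) (Fn f ts)"
        if "length as = ?n" for as
      proof -
        have "(\<lambda>x. (as \<frown> e) (x + Suc ?n)) = e \<circ> Suc" using that by auto
        then show ?thesis
          using that eval_list_unique[OF that, of e M "e \<circ> Suc"] map_conc[of as e] by auto
      qed
      then show "(\<exists>as. length as = ?n \<and> set as \<subseteq> C \<and> ?R as) \<longleftrightarrow> e 0 = eval_trm M (e \<circ> Suc) (Fn f ts)"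
        by (rule one_point[OF _ _ eval_carrier[OF e' ts]]) simp_all
    qed
  qed
  have atom: "Q (\<lambda>e. P (map (eval_trm M e) ts))"
    if ts: "list_all (wf_trm (slang M)) ts" and P: "Q (\<lambda>e. P (map e [0..<length ts]))" for P ts
  proof -
    let ?n = "length ts"
    \<comment> \<open>An atomic formula has no value variable of its own, hence the offset
      \<open>?n\<close> in place of \<open>Suc ?n\<close>.\<close>
    have "Q (\<lambda>e. \<forall>i<?n. e i = eval_trm M (\<lambda>x. e (x + ?n)) (ts ! i))"
      using trm ts unfolding list_all_iff by (intro eval_list) blast
    from ex_list[OF conj[OF this P], of ?n]
    show ?thesis
    proof (rule cong)
      fix e :: "nat \<Rightarrow> 'a" assume e: "range e \<subseteq> C"
      let ?R = "\<lambda>as. (\<forall>i<?n. (as \<frown> e) i = eval_trm M (\<lambda>x. (as \<frown> e) (x + ?n)) (ts ! i)) \<and>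
         P (map (as \<frown> e) [0..<?n])"
      have "?R as \<longleftrightarrow> as = map (eval_trm M e) ts \<and> P (map (eval_trm M e) ts)" if "length as = ?n" for as
      proof -
        have "(\<lambda>x. (as \<frown> e) (x + ?n)) = e" using that by auto
        then show ?thesis
          using that eval_list_unique[OF that, of e M e] map_conc[of as e] by auto
      qed
      then show "(\<exists>as. length as = ?n \<and> set as \<subseteq> C \<and> ?R as) \<longleftrightarrow> P (map (eval_trm M e) ts)"
        by (rule one_point[OF _ _ eval_carrier[OF e ts]]) simp_all
    qed
  qed
  show ?thesis
    using \<open>wf_fm (slang M) \<phi>\<close>
  proof (induction \<phi>)
    case (Eq s t)
    \<comment> \<open>Equality is treated as a binary relation on the list
      \<open>[s, t]\<close>.\<close>
    have "Q (\<lambda>e. map e [0..<length [s, t]] ! 0 = map e [0..<length [s, t]] ! 1)"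
      using eq by (simp add: upt_rec)
    from atom[OF _ this] Eq show ?case by simp
  next
    case (Rel r ts)
    then show ?case using atom[OF _ rel, of ts r] by simp
  next
    case (Ex x \<phi>)
    have "Q (\<lambda>e. sat M e \<phi>)" using Ex by simp
    \<comment> \<open>The substitution sends \<open>x\<close> to the bound variable 0 and moves the
      others up, turning the de Bruijn quantifier into a named one.\<close>
    then have "Q (\<lambda>e. \<exists>a\<in>C. sat M (([a] \<frown> e) \<circ> (\<lambda>i. if i = x then 0 else Suc i)) \<phi>)"
      by (rule ex[OF subst])
    moreover have "([a] \<frown> e) \<circ> (\<lambda>i. if i = x then 0 else Suc i) = e(x := a)" for a and e :: "nat \<Rightarrow> 'a"
      by auto
    ultimately show ?case unfolding sat.simps C by simp
  qed (auto intro: neg conj)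
qed

text \<open>
  The finitely many parameters come first; \<open>\<frown>\<close> prepends a list to an assignment, and a quantifier
  binds variable 0 of \<open>P\<close> as in de Bruijn notation, which avoids fresh variables.
\<close>

definition definable_pred :: "('f, 'r, 'a) fo_struct \<Rightarrow> ((nat \<Rightarrow> 'a) \<Rightarrow> bool) \<Rightarrow> bool" where
  "definable_pred N P \<longleftrightarrow> (\<exists>\<psi> ps. wf_fm (slang N) \<psi> \<and> set ps \<subseteq> carrier N \<and>
     (\<forall>h. range h \<subseteq> carrier N \<longrightarrow> (P h \<longleftrightarrow> sat N (ps \<frown> h) \<psi>)))"

lemma definable_predI:
  assumes "wf_fm (slang N) \<psi>" "set ps \<subseteq> carrier N"
    "\<And>h. range h \<subseteq> carrier N \<Longrightarrow> P h \<longleftrightarrow> sat N (ps \<frown> h) \<psi>"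
  shows "definable_pred N P"
  using assms unfolding definable_pred_def by blast

lemma definable_predE:
  assumes "definable_pred N P"
  obtains \<psi> ps where "wf_fm (slang N) \<psi>" "set ps \<subseteq> carrier N"
    "\<And>h. range h \<subseteq> carrier N \<Longrightarrow> P h \<longleftrightarrow> sat N (ps \<frown> h) \<psi>"
  using assms unfolding definable_pred_def by blast

text \<open>The logical operations act on the defining formulas; the work lies in renaming variables
  around the parameter lists.\<close>

interpretation definable_pred: predicate_family "carrier N" "definable_pred N"
  for N :: "('f, 'r, 'a) fo_struct"
proof
  fix P P' :: "(nat \<Rightarrow> 'a) \<Rightarrow> bool"
  assume "definable_pred N P" "\<And>e. range e \<subseteq> carrier N \<Longrightarrow> P e \<longleftrightarrow> P' e"
  then show "definable_pred N P'" unfolding definable_pred_def by metis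
next
  show "definable_pred N (\<lambda>e. True)"
    by (rule definable_predI[of _ "Eq (Var 0) (Var 0)" "[]"]) auto
next
  fix P :: "(nat \<Rightarrow> 'a) \<Rightarrow> bool"
  assume "definable_pred N P"
  then obtain \<psi> ps where *: "wf_fm (slang N) \<psi>" "set ps \<subseteq> carrier N"
    "\<And>h. range h \<subseteq> carrier N \<Longrightarrow> P h \<longleftrightarrow> sat N (ps \<frown> h) \<psi>"
    by (rule definable_predE) blast
  then show "definable_pred N (\<lambda>e. \<not> P e)"
    by (intro definable_predI[of _ "Neg \<psi>" ps]) auto
  show "definable_pred N (\<lambda>e. P (e \<circ> \<sigma>))" for \<sigma>
  proof (rule definable_predI)
    let ?\<rho> = "\<lambda>i. if i < length ps then i else \<sigma> (i - length ps) + length ps"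
    show "wf_fm (slang N) (rename \<psi> ?\<rho>)" by (simp add: *)
    fix h :: "nat \<Rightarrow> 'a" assume "range h \<subseteq> carrier N"
    moreover have "(ps \<frown> h) \<circ> ?\<rho> = ps \<frown> (h \<circ> \<sigma>)" by (auto simp: conc_def)
    moreover have "range (h \<circ> \<sigma>) \<subseteq> carrier N" using calculation(1) by auto
    ultimately show "P (h \<circ> \<sigma>) \<longleftrightarrow> sat N (ps \<frown> h) (rename \<psi> ?\<rho>)"
      unfolding sat_rename by (simp add: *(3))
  qed (rule *)
  show "definable_pred N (\<lambda>e. \<exists>a\<in>carrier N. P ([a] \<frown> e))"
  proof (rule definable_predI)
    \<comment> \<open>\<open>Ex\<close> binds the variable right after the parameters; later
      variables drop by one because \<open>[a]\<close> no longer stands in front.\<close>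
    let ?n = "length ps" and ?\<rho> = "\<lambda>i. if i \<le> length ps then i else i - 1"
    show "wf_fm (slang N) (rename (Ex ?n \<psi>) ?\<rho>)" using *(1) by (intro wf_rename) simp
    fix h :: "nat \<Rightarrow> 'a" assume h: "range h \<subseteq> carrier N"
    have "((ps \<frown> h) \<circ> ?\<rho>)(?n := a) = ps \<frown> ([a] \<frown> h)" for a
      by (auto simp: fun_eq_iff conc_def nth_append less_Suc_eq)
    moreover have "P ([a] \<frown> h) \<longleftrightarrow> sat N (ps \<frown> ([a] \<frown> h)) \<psi>" if "a \<in> carrier N" for a
      using that h by (intro *(3)) auto
    ultimately show "(\<exists>a\<in>carrier N. P ([a] \<frown> h)) \<longleftrightarrow> sat N (ps \<frown> h) (rename (Ex ?n \<psi>) ?\<rho>)"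
      unfolding sat_rename by simp
  qed (rule *)
  show "definable_pred N (\<lambda>e. P e \<and> P' e)" if "definable_pred N P'" for P'
  proof -
    from that obtain \<psi>' ps' where psi': "wf_fm (slang N) \<psi>'" "set ps' \<subseteq> carrier N"
      "\<And>h. range h \<subseteq> carrier N \<Longrightarrow> P' h \<longleftrightarrow> sat N (ps' \<frown> h) \<psi>'"
      by (rule definable_predE) blast
    show ?thesis
    proof (rule definable_predI)
      \<comment> \<open>The parameter lists are joined, and each formula has its variables moved
        past the parameters of the other.\<close>
      let ?\<rho> = "\<lambda>i. if i < length ps then i else i + length ps'" and ?\<rho>' = "\<lambda>i. i + length ps"
      show "wf_fm (slang N) (Conj (rename \<psi> ?\<rho>) (rename \<psi>' ?\<rho>'))" by (simp add: * psi')
      show "set (ps @ ps') \<subseteq> carrier N" by (simp add: *(2) psi'(2))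
      fix h :: "nat \<Rightarrow> 'a" assume "range h \<subseteq> carrier N"
      moreover have "((ps @ ps') \<frown> h) \<circ> ?\<rho> = ps \<frown> h" by (auto simp: conc_def nth_append)
      moreover have "((ps @ ps') \<frown> h) \<circ> ?\<rho>' = ps' \<frown> h"
        by (auto simp: fun_eq_iff conc_def nth_append)
      ultimately show "P h \<and> P' h \<longleftrightarrow> sat N ((ps @ ps') \<frown> h) (Conj (rename \<psi> ?\<rho>) (rename \<psi>' ?\<rho>'))"
        unfolding sat.simps sat_rename by (simp add: *(3) psi'(3))
    qed
  qed
qed

section \<open>Passage between definable sets and definable predicates\<close>

lemma definable_subset_tuples: "definable N m X \<Longrightarrow> X \<subseteq> tuples N m"
  unfolding definable_def by auto

text \<open>Only finitely many variables are free in the formula, so an initial segment of the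
  parameter assignment suffices as parameter list.\<close>

lemma definable_pred_of_definable:
  fixes N :: "('f, 'r, 'a) fo_struct"
  assumes "definable N m X"
  shows "definable_pred N (\<lambda>h. map h [0..<m] \<in> X)"
proof -
  obtain \<phi> e where \<phi>: "wf_fm (slang N) \<phi>" and e: "range e \<subseteq> carrier N"
    and X: "X = {as \<in> tuples N m. sat N (\<lambda>i. if i < m then as ! i else e i) \<phi>}"
    using assms unfolding definable_def by blast
  obtain K where K: "\<And>x. x \<in> free_vars \<phi> \<Longrightarrow> x < K" using free_vars_bound by blast
  show ?thesis
  proof (rule definable_predI)
    \<comment> \<open>Coordinates move past the \<open>K\<close> parameters; the other free
      variables already index the list correctly.\<close>
    let ?\<rho> = "\<lambda>i. if i < m then i + K else i"
    show "wf_fm (slang N) (rename \<phi> ?\<rho>)" using \<phi> by simp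
    show "set (map e [0..<K]) \<subseteq> carrier N" using e by auto
    fix h :: "nat \<Rightarrow> 'a" assume h: "range h \<subseteq> carrier N"
    have "map h [0..<m] \<in> X \<longleftrightarrow> sat N (\<lambda>i. if i < m then map h [0..<m] ! i else e i) \<phi>"
      using h by (auto simp: X tuples_def)
    also have "\<dots> \<longleftrightarrow> sat N ((map e [0..<K] \<frown> h) \<circ> ?\<rho>) \<phi>"
      by (rule sat_cong) (auto simp: conc_def dest: K)
    finally show "map h [0..<m] \<in> X \<longleftrightarrow> sat N (map e [0..<K] \<frown> h) (rename \<phi> ?\<rho>)" by simp
  qed
qed

text \<open>\<open>definable\<close> expects the coordinates first, so the parameter block and the
  coordinate block are exchanged; \<open>q\<close> supplies the values beyond both.\<close>

lemma definable_of_sat: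
  assumes \<psi>: "wf_fm (slang N) \<psi>" and ps: "set ps \<subseteq> carrier N" and q: "range q \<subseteq> carrier N"
  shows "definable N n {bs \<in> tuples N n. sat N (ps \<frown> bs \<frown> q) \<psi>}"
  unfolding definable_def
proof (intro exI conjI)
  let ?l = "length ps"
  let ?\<rho> = "\<lambda>i. if i < ?l then n + i else if i < ?l + n then i - ?l else i"
  let ?e = "\<lambda>j. (ps \<frown> q) (j - n)"
  show "wf_fm (slang N) (rename \<psi> ?\<rho>)" using \<psi> by simp
  show "range ?e \<subseteq> carrier N" using ps q range_conc[of ps q] by blast
  have "(\<lambda>i. if i < n then bs ! i else ?e i) \<circ> ?\<rho> = ps \<frown> bs \<frown> q" if "length bs = n" for bs
    using that by (auto simp: fun_eq_iff conc_def nth_append add.commute)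
  then show "{bs \<in> tuples N n. sat N (ps \<frown> bs \<frown> q) \<psi>} =
      {as \<in> tuples N n. sat N (\<lambda>i. if i < n then as ! i else ?e i) (rename \<psi> ?\<rho>)}"
    unfolding sat_rename by (auto simp: tuples_def simp del: conc_conc)
qed

section \<open>Interpretations\<close>

text \<open>An assignment in \<open>N\<close> is cut into consecutive \<open>k\<close>-tuples, one
  for each variable of the interpreted structure.\<close>

definition block :: "nat \<Rightarrow> (nat \<Rightarrow> 'a) \<Rightarrow> nat \<Rightarrow> 'a list" where
  "block k h x = map (\<lambda>i. h (x * k + i)) [0..<k]"

lemma block_conc:
  assumes "length bs = k"
  shows "block k (bs \<frown> h) = [bs] \<frown> block k h"
proof
  fix x
  show "block k (bs \<frown> h) x = ([bs] \<frown> block k h) x"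
  proof (cases x)
    case 0
    then show ?thesis using assms by (auto simp: block_def intro: nth_equalityI)
  next
    case (Suc y)
    then show ?thesis using assms by (simp add: block_def conc_def)
  qed
qed

text \<open>\<open>Q\<close> speaks about the interpreted structure. Agreement is demanded only when
  every block lies in \<open>D\<close>, so the domain has to be mentioned only at
  quantifiers.\<close>

definition pulled_back ::
    "('f, 'r, 'a) fo_struct \<Rightarrow> nat \<Rightarrow> 'a list set \<Rightarrow> ('a list \<Rightarrow> 'b) \<Rightarrow> ((nat \<Rightarrow> 'b) \<Rightarrow> bool) \<Rightarrow> bool" where
  "pulled_back N k D \<pi> Q \<longleftrightarrow> (\<exists>P. definable_pred N P \<and>
     (\<forall>h. range h \<subseteq> carrier N \<and> range (block k h) \<subseteq> D \<longrightarrow> (P h \<longleftrightarrow> Q (\<pi> \<circ> block k h))))"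

lemma pulled_backI:
  assumes "definable_pred N P"
    "\<And>h. range h \<subseteq> carrier N \<Longrightarrow> range (block k h) \<subseteq> D \<Longrightarrow> P h \<longleftrightarrow> Q (\<pi> \<circ> block k h)"
  shows "pulled_back N k D \<pi> Q"
  using assms unfolding pulled_back_def by blast

lemma pulled_backE:
  assumes "pulled_back N k D \<pi> Q"
  obtains P where "definable_pred N P"
    "\<And>h. range h \<subseteq> carrier N \<Longrightarrow> range (block k h) \<subseteq> D \<Longrightarrow> P h \<longleftrightarrow> Q (\<pi> \<circ> block k h)"
  using assms unfolding pulled_back_def by blast

text \<open>Boolean operations commute with pulling back, a change of variables moves whole blocks,
  and quantification over the image of \<open>\<pi>\<close> is quantification over tuples in
  \<open>D\<close>.\<close>

lemma predicate_family_pulled_back: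
  fixes N :: "('f, 'r, 'a) fo_struct" and \<pi> :: "'a list \<Rightarrow> 'b"
  assumes D: "definable N k D"
  shows "predicate_family (\<pi> ` D) (pulled_back N k D \<pi>)"
proof
  fix P P' :: "(nat \<Rightarrow> 'b) \<Rightarrow> bool"
  assume P: "pulled_back N k D \<pi> P" and eq: "\<And>e. range e \<subseteq> \<pi> ` D \<Longrightarrow> P e \<longleftrightarrow> P' e"
  from P obtain R where R: "definable_pred N R"
    "\<And>h. range h \<subseteq> carrier N \<Longrightarrow> range (block k h) \<subseteq> D \<Longrightarrow> R h \<longleftrightarrow> P (\<pi> \<circ> block k h)"
    by (rule pulled_backE) blast
  show "pulled_back N k D \<pi> P'"
  proof (rule pulled_backI[OF R(1)])
    fix h :: "nat \<Rightarrow> 'a" assume h: "range h \<subseteq> carrier N" "range (block k h) \<subseteq> D"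
    then have "range (\<pi> \<circ> block k h) \<subseteq> \<pi> ` D" by auto
    then show "R h \<longleftrightarrow> P' (\<pi> \<circ> block k h)" using R(2)[OF h] eq by blast
  qed
next
  show "pulled_back N k D \<pi> (\<lambda>e. True)"
    by (rule pulled_backI[OF definable_pred.top]) simp
next
  fix P :: "(nat \<Rightarrow> 'b) \<Rightarrow> bool"
  assume "pulled_back N k D \<pi> P"
  then obtain R where R: "definable_pred N R"
    "\<And>h. range h \<subseteq> carrier N \<Longrightarrow> range (block k h) \<subseteq> D \<Longrightarrow> R h \<longleftrightarrow> P (\<pi> \<circ> block k h)"
    by (rule pulled_backE) blast
  show "pulled_back N k D \<pi> (\<lambda>e. \<not> P e)"
    by (rule pulled_backI[OF definable_pred.neg[OF R(1)]]) (simp add: R(2))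
  show "pulled_back N k D \<pi> (\<lambda>e. P e \<and> P' e)" if "pulled_back N k D \<pi> P'" for P'
  proof -
    from that obtain R' where R': "definable_pred N R'"
      "\<And>h. range h \<subseteq> carrier N \<Longrightarrow> range (block k h) \<subseteq> D \<Longrightarrow> R' h \<longleftrightarrow> P' (\<pi> \<circ> block k h)"
      by (rule pulled_backE) blast
    show ?thesis
      by (rule pulled_backI[OF definable_pred.conj[OF R(1) R'(1)]]) (simp add: R(2) R'(2))
  qed
  show "pulled_back N k D \<pi> (\<lambda>e. P (e \<circ> \<sigma>))" for \<sigma>
  proof (rule pulled_backI[OF definable_pred.subst[OF R(1)]])
    \<comment> \<open>Position \<open>j\<close> is entry \<open>j mod k\<close> of block
      \<open>j div k\<close>; only the block index is changed.\<close>
    let ?\<rho> = "\<lambda>j. \<sigma> (j div k) * k + j mod k"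
    fix h :: "nat \<Rightarrow> 'a" assume h: "range h \<subseteq> carrier N" "range (block k h) \<subseteq> D"
    have "block k (h \<circ> ?\<rho>) = block k h \<circ> \<sigma>" by (auto simp: block_def)
    moreover have "range (h \<circ> ?\<rho>) \<subseteq> carrier N" "range (block k h \<circ> \<sigma>) \<subseteq> D" using h by auto
    ultimately show "R (h \<circ> ?\<rho>) \<longleftrightarrow> P (\<pi> \<circ> block k h \<circ> \<sigma>)"
      using R(2)[of "h \<circ> ?\<rho>"] by (simp add: comp_assoc)
  qed
  \<comment> \<open>The quantified block is relativised to the definable set
    \<open>D\<close>.\<close>
  have "definable_pred N (\<lambda>h. map h [0..<k] \<in> D \<and> R h)"
    by (intro definable_pred.conj definable_pred_of_definable D R(1))
  from definable_pred.ex_list[OF this, of k]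
  show "pulled_back N k D \<pi> (\<lambda>e. \<exists>a\<in>\<pi> ` D. P ([a] \<frown> e))"
  proof (rule pulled_backI)
    fix h :: "nat \<Rightarrow> 'a" assume h: "range h \<subseteq> carrier N" "range (block k h) \<subseteq> D"
    have "map (bs \<frown> h) [0..<k] = bs" if "length bs = k" for bs
      using that by (intro nth_equalityI) simp_all
    moreover have "R (bs \<frown> h) \<longleftrightarrow> P ([\<pi> bs] \<frown> (\<pi> \<circ> block k h))" if "bs \<in> D" for bs
    proof -
      have bs: "length bs = k" "set bs \<subseteq> carrier N"
        using definable_subset_tuples[OF D] that by (auto simp: tuples_def)
      have "\<pi> \<circ> ([bs] \<frown> block k h) = [\<pi> bs] \<frown> (\<pi> \<circ> block k h)"
        by (auto simp: conc_def)
      moreover have "range (block k (bs \<frown> h)) \<subseteq> D" "range (bs \<frown> h) \<subseteq> carrier N"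
        using h bs that by (auto simp: block_conc simp del: comp_apply)
      ultimately show ?thesis using R(2)[of "bs \<frown> h"] bs by (simp add: block_conc)
    qed
    moreover have "length bs = k \<and> set bs \<subseteq> carrier N" if "bs \<in> D" for bs
      using definable_subset_tuples[OF D] that by (auto simp: tuples_def)
    ultimately show "(\<exists>bs. length bs = k \<and> set bs \<subseteq> carrier N \<and> map (bs \<frown> h) [0..<k] \<in> D \<and> R (bs \<frown> h)) \<longleftrightarrow>
        (\<exists>a\<in>\<pi> ` D. P ([a] \<frown> (\<pi> \<circ> block k h)))"
      unfolding bex_simps(7) by (metis (no_types, lifting))
  qed
qed

text \<open>A list of tuples can be recovered from its concatenation because all the tuples have
  length \<open>k\<close>.\<close>

lemma pulled_back_of_definable:
  fixes N :: "('f, 'r, 'a) fo_struct"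
  assumes "definable N (m * k) (pullback \<pi> D m X)" and D: "D \<subseteq> tuples N k"
  shows "pulled_back N k D \<pi> (\<lambda>e. map e [0..<m] \<in> X)"
proof (rule pulled_backI[OF definable_pred_of_definable[OF assms(1)]])
  fix h :: "nat \<Rightarrow> 'a" assume h: "range h \<subseteq> carrier N" "range (block k h) \<subseteq> D"
  define cs where "cs = map (block k h) [0..<m]"
  have "map h [0..<m * k] = concat (map (block k h) [0..<m])"
  proof (induction m)
    case (Suc m)
    have "map h [0..<Suc m * k] = map h [0..<m * k] @ map h [m * k..<m * k + k]"
      by (metis add.commute map_append mult_Suc upt_add_eq_append zero_le)
    also have "map h [m * k..<m * k + k] = block k h m"
      by (auto simp: block_def intro: nth_equalityI)
    finally show ?case by (simp add: Suc)
  qed simp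
  then have cs: "map h [0..<m * k] = concat cs" by (simp add: cs_def)
  have "bs = cs" if "concat cs = concat bs" "length bs = m" "set bs \<subseteq> D" for bs
  proof -
    have "length b = k" if "b \<in> set bs" for b
      using that \<open>set bs \<subseteq> D\<close> D by (auto simp: tuples_def)
    moreover have "length c = k" if "c \<in> set cs" for c
      using that by (auto simp: cs_def block_def)
    ultimately have "\<forall>(x, y)\<in>set (zip cs bs). length x = length y"
      by (auto dest: set_zip_leftD set_zip_rightD)
    moreover have "length cs = length bs" by (simp add: cs_def that)
    ultimately show ?thesis using that(1) concat_eq_concat_iff by blast
  qed
  moreover have "length cs = m" "set cs \<subseteq> D" using h(2) by (auto simp: cs_def)
  ultimately have "map h [0..<m * k] \<in> pullback \<pi> D m X \<longleftrightarrow> map \<pi> cs \<in> X"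
    unfolding pullback_def cs by blast
  then show "map h [0..<m * k] \<in> pullback \<pi> D m X \<longleftrightarrow> map (\<pi> \<circ> block k h) [0..<m] \<in> X"
    by (simp add: cs_def)
qed

section \<open>Coding assignments by tuples laid end to end\<close>

definition flat :: "nat \<Rightarrow> ('b \<Rightarrow> 'a list) \<Rightarrow> (nat \<Rightarrow> 'b) \<Rightarrow> nat \<Rightarrow> 'a" where
  "flat k s e j = s (e (j div k)) ! (j mod k)"

lemma block_flat:
  assumes "\<And>x. length (s (e x)) = k"
  shows "block k (flat k s e) = s \<circ> e"
  using assms by (auto simp: block_def flat_def fun_eq_iff intro!: nth_equalityI)

lemma range_flat:
  assumes "k \<ge> 1" "\<And>a. a \<in> A \<Longrightarrow> s a \<in> tuples N k" "range e \<subseteq> A"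
  shows "range (flat k s e) \<subseteq> carrier N"
proof
  fix b assume "b \<in> range (flat k s e)"
  then obtain j where "b = s (e (j div k)) ! (j mod k)" by (auto simp: flat_def)
  moreover have "s (e (j div k)) \<in> tuples N k" using assms by blast
  moreover have "j mod k < k" using assms(1) by simp
  ultimately show "b \<in> carrier N" by (auto simp: tuples_def)
qed

text \<open>Separates the codes of the coordinates from those of the parameters, as trace
  definability requires.\<close>

lemma flat_conc:
  assumes "\<And>a. a \<in> set as \<Longrightarrow> length (s a) = k" "k \<ge> 1"
  shows "concat (map s as) \<frown> flat k s e = flat k s (as \<frown> e)"
  using assms(1)
proof (induction as)
  case (Cons a as)
  have "s a \<frown> flat k s f = flat k s ([a] \<frown> f)" for f
  proof
    fix j
    show "(s a \<frown> flat k s f) j = flat k s ([a] \<frown> f) j"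
    proof (cases "j < k")
      case True
      then show ?thesis using Cons.prems by (simp add: flat_def)
    next
      case False
      then have "j div k = Suc ((j - k) div k)" "j mod k = (j - k) mod k"
        using assms(2) by (simp_all add: le_div_geq le_mod_geq)
      then show ?thesis using Cons.prems False by (simp add: flat_def)
    qed
  qed
  from this[of "as \<frown> e"] Cons show ?case by (simp flip: conc_conc)
qed simp

text \<open>
  The uniform part of an interpretation that survives the passage from \<open>M\<close> to an elementarily
  equivalent structure: there is no definable domain, and \<open>s\<close> need not be a section of anything.
\<close>

definition formula_coding ::
    "('f, 'r, 'a) fo_struct \<Rightarrow> ('g, 's, 'b) fo_struct \<Rightarrow> nat \<Rightarrow> ('b \<Rightarrow> 'a list) \<Rightarrow> bool" where
  "formula_coding N M k s \<longleftrightarrow> k \<ge> 1 \<and> s ` carrier M \<subseteq> tuples N k \<and>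
     (\<forall>\<phi>. wf_fm (slang M) \<phi> \<longrightarrow> (\<exists>\<psi> ps. wf_fm (slang N) \<psi> \<and> set ps \<subseteq> carrier N \<and>
        (\<forall>e. range e \<subseteq> carrier M \<longrightarrow> (sat M e \<phi> \<longleftrightarrow> sat N (ps \<frown> flat k s e) \<psi>))))"

text \<open>Satisfaction in \<open>M\<close> pulls back to a definable predicate; reading this along
  a section of \<open>\<pi>\<close> gives the translated formula.\<close>

lemma interprets_imp_formula_coding:
  fixes N :: "('f, 'r, 'a) fo_struct" and M :: "('g, 's, 'b) fo_struct"
  assumes M: "is_structure M" and "interprets N M"
  obtains k s where "formula_coding N M k s"
proof -
  obtain k D \<pi> where k: "k \<ge> 1" and D: "definable N k D" and \<pi>: "\<pi> ` D = carrier M"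
    and eq: "definable N (2 * k) (pullback \<pi> D 2 {[a, a] | a. a \<in> carrier M})"
    and rel': "\<forall>(r, m) \<in> rels (slang M).
        definable N (m * k) (pullback \<pi> D m {as \<in> tuples M m. rel_int M r as})"
    and fn': "\<forall>(f, m) \<in> funs (slang M). definable N ((m + 1) * k)
          (pullback \<pi> D (m + 1) {as @ [fun_int M f as] | as. as \<in> tuples M m})"
    using \<open>interprets N M\<close> unfolding interprets_def by (elim exE conjE) (rule that)
  have rel: "definable N (m * k) (pullback \<pi> D m {as \<in> tuples M m. rel_int M r as})"
    if "(r, m) \<in> rels (slang M)" for r m
    using bspec[OF rel' that] by simp
  have fn: "definable N ((m + 1) * k)
      (pullback \<pi> D (m + 1) {as @ [fun_int M f as] | as. as \<in> tuples M m})"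
    if "(f, m) \<in> funs (slang M)" for f m
    using bspec[OF fn' that] by simp
  interpret predicate_family "carrier M" "pulled_back N k D \<pi>"
    using predicate_family_pulled_back[OF D] \<pi> by metis
  note D' = definable_subset_tuples[OF D]
  have sat: "pulled_back N k D \<pi> (\<lambda>e. sat M e \<phi>)" if "wf_fm (slang M) \<phi>" for \<phi>
  \<comment> \<open>The clauses of an interpretation provide exactly the atomic cases.\<close>
  proof (rule sat_in_family[OF M refl _ _ _ that])
    show "pulled_back N k D \<pi> (\<lambda>e. e 0 = e 1)"
      by (rule cong[OF pulled_back_of_definable[OF eq D']]) (auto simp: upt_rec)
    show "pulled_back N k D \<pi> (\<lambda>e. rel_int M r (map e [0..<m]))"
      if "(r, m) \<in> rels (slang M)" for r m
      by (rule cong[OF pulled_back_of_definable[OF rel[OF that] D']]) (auto simp: tuples_def)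
    show "pulled_back N k D \<pi> (\<lambda>e. e m = fun_int M f (map e [0..<m]))"
      if "(f, m) \<in> funs (slang M)" for f m
      by (rule cong[OF pulled_back_of_definable[OF fn[OF that] D']]) (auto simp: tuples_def)
  qed
  define s where "s = inv_into D \<pi>"
  have s: "s a \<in> D" "\<pi> (s a) = a" if "a \<in> carrier M" for a
    using that \<pi> by (auto simp: s_def inv_into_into f_inv_into_f)
  have s_tuples: "s a \<in> tuples N k" if "a \<in> carrier M" for a using s(1)[OF that] D' by blast
  have "\<exists>\<psi> ps. wf_fm (slang N) \<psi> \<and> set ps \<subseteq> carrier N \<and>
      (\<forall>e. range e \<subseteq> carrier M \<longrightarrow> (sat M e \<phi> \<longleftrightarrow> sat N (ps \<frown> flat k s e) \<psi>))"
    if \<phi>: "wf_fm (slang M) \<phi>" for \<phi>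
  proof -
    obtain P where P: "definable_pred N P"
      "\<And>h. range h \<subseteq> carrier N \<Longrightarrow> range (block k h) \<subseteq> D \<Longrightarrow> P h \<longleftrightarrow> sat M (\<pi> \<circ> block k h) \<phi>"
      using sat[OF \<phi>] by (rule pulled_backE) blast
    obtain \<psi> ps where \<psi>: "wf_fm (slang N) \<psi>" "set ps \<subseteq> carrier N"
      "\<And>h. range h \<subseteq> carrier N \<Longrightarrow> P h \<longleftrightarrow> sat N (ps \<frown> h) \<psi>"
      using P(1) by (rule definable_predE) blast
    have "sat M e \<phi> \<longleftrightarrow> sat N (ps \<frown> flat k s e) \<psi>" if e: "range e \<subseteq> carrier M" for e
    proof -
      have flat: "range (flat k s e) \<subseteq> carrier N"
        using range_flat[OF k s_tuples e] .
      have "length (s (e x)) = k" for x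
        using s_tuples[of "e x"] e by (auto simp: tuples_def)
      then have block: "block k (flat k s e) = s \<circ> e" by (rule block_flat)
      \<comment> \<open>Decoding the flattened codes returns \<open>e\<close>, so the pulled-back
        predicate evaluates \<open>\<phi>\<close> at \<open>e\<close>.\<close>
      have "\<pi> \<circ> block k (flat k s e) = e"
        using s(2) e by (auto simp: block fun_eq_iff)
      moreover have "range (block k (flat k s e)) \<subseteq> D" using s(1) e by (auto simp: block)
      ultimately show ?thesis using P(2)[OF flat] \<psi>(3)[OF flat] by simp
    qed
    with \<psi> show ?thesis by blast
  qed
  then have "formula_coding N M k s"
    unfolding formula_coding_def using k s_tuples by blast
  then show thesis by (rule that)
qed

text \<open>Parameters in \<open>M\<close> are replaced by their codes, which become parameters in
  \<open>N\<close> next to those of the translated formula.\<close>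

lemma formula_coding_imp_trace_defines:
  fixes N :: "('f, 'r, 'a) fo_struct" and M :: "('g, 's, 'b) fo_struct"
  assumes "formula_coding N M k s"
  shows "trace_defines N M"
  unfolding trace_defines_def
proof (intro exI[of _ k] exI[of _ s] conjI allI impI)
  show k: "k \<ge> 1" and s: "s ` carrier M \<subseteq> tuples N k"
    using assms unfolding formula_coding_def by blast+
  fix m X assume "m \<ge> 1" "definable M m X"
  then obtain \<phi> e where \<phi>: "wf_fm (slang M) \<phi>" and e: "range e \<subseteq> carrier M"
    and X: "X = {as \<in> tuples M m. sat M (\<lambda>i. if i < m then as ! i else e i) \<phi>}"
    unfolding definable_def by blast
  obtain \<psi> ps where \<psi>: "wf_fm (slang N) \<psi>" "set ps \<subseteq> carrier N"
    and sat: "\<And>e. range e \<subseteq> carrier M \<Longrightarrow> sat M e \<phi> \<longleftrightarrow> sat N (ps \<frown> flat k s e) \<psi>"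
    using assms \<phi> unfolding formula_coding_def by blast
  \<comment> \<open>The values of \<open>e\<close> from position \<open>m\<close> on, so that
    \<open>as \<frown> e'\<close> is the assignment used by \<open>definable\<close>.\<close>
  define e' where "e' i = e (i + m)" for i
  have e': "range e' \<subseteq> carrier M" using e by (auto simp: e'_def)
  have flat: "range (flat k s e') \<subseteq> carrier N"
    using range_flat[OF k _ e'] s by blast
  define Y where "Y = {bs \<in> tuples N (m * k). sat N (ps \<frown> bs \<frown> flat k s e') \<psi>}"
  have "definable N (m * k) Y"
    unfolding Y_def by (rule definable_of_sat[OF \<psi> flat])
  moreover have "sat M (\<lambda>i. if i < m then as ! i else e i) \<phi> \<longleftrightarrow> concat (map s as) \<in> Y"
    if as: "as \<in> tuples M m" for as
  proof -
    have s_as: "length (s a) = k \<and> set (s a) \<subseteq> carrier N" if "a \<in> set as" for a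
      using that as s by (auto simp: tuples_def)
    have "sum_list (map (length \<circ> s) as) = m * k"
      using s_as as by (simp add: tuples_def comp_def sum_list_triv cong: map_cong)
    then have "concat (map s as) \<in> tuples N (m * k)"
      using s_as by (auto simp: tuples_def length_concat)
    moreover have "(\<lambda>i. if i < m then as ! i else e i) = as \<frown> e'"
      using as by (auto simp: e'_def tuples_def conc_def)
    moreover have "range (as \<frown> e') \<subseteq> carrier M" using as e' by (auto simp: tuples_def)
    ultimately show ?thesis
      using sat[of "as \<frown> e'"] flat_conc[of as s k e'] s_as k by (simp add: Y_def del: conc_conc)
  qed
  ultimately show "\<exists>Y. definable N (m * k) Y \<and> X = {as \<in> tuples M m. concat (map s as) \<in> Y}"
    unfolding X by blast
qed

section \<open>Ultrapowers\<close>

text \<open>Zorn's lemma yields a minimal proper filter below \<open>F\<close>, and minimality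
  forces it to decide every predicate.\<close>

lemma ultrafilter_exists:
  assumes "F \<noteq> bot"
  obtains U where "U \<le> F" "U \<noteq> bot" "\<And>P. \<not> eventually P U \<longleftrightarrow> eventually (\<lambda>x. \<not> P x) U"
proof -
  let ?A = "{G. G \<le> F \<and> G \<noteq> bot}"
  have "\<exists>U\<in>?A. \<forall>G\<in>?A. U \<ge> G \<longrightarrow> G = U"
  proof (rule predicate_Zorn)
    show "partial_order_on ?A (relation_of (\<ge>) ?A)"
      by (rule partial_order_on_relation_ofI) auto
    fix C assume C: "C \<in> Chains (relation_of (\<ge>) ?A)"
    then have sub: "C \<subseteq> ?A" and chain: "\<And>G H. G \<in> C \<Longrightarrow> H \<in> C \<Longrightarrow> G \<le> H \<or> H \<le> G"
      by (auto simp: Chains_def relation_of_def)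
    show "\<exists>U\<in>?A. \<forall>G\<in>C. G \<ge> U"
    proof (cases "C = {}")
      case True
      then show ?thesis using assms by auto
    next
      case False
      \<comment> \<open>A chain is directed, so what holds eventually for its infimum does so for a
        member; hence the infimum stays proper.\<close>
      have "eventually P (Inf C) \<longleftrightarrow> (\<exists>G\<in>C. eventually P G)" for P
        by (rule eventually_Inf_base[OF False]) (metis chain inf.absorb1 inf.absorb2 order_refl)
      then have "Inf C \<noteq> bot" using sub by (auto simp: trivial_limit_def)
      moreover have "Inf C \<le> F"
      proof -
        obtain G where "G \<in> C" using False by blast
        then show ?thesis using sub Inf_lower2[of G C F] by blast
      qed
      ultimately show ?thesis by (auto intro: Inf_lower)
    qed
  qed
  then obtain U where U: "U \<le> F" "U \<noteq> bot"
    and min: "\<And>G. G \<le> F \<Longrightarrow> G \<noteq> bot \<Longrightarrow> G \<le> U \<Longrightarrow> G = U" by blast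
  have "eventually (\<lambda>x. \<not> P x) U" if "\<not> eventually P U" for P
  proof -
    \<comment> \<open>Adjoining the complement of \<open>P\<close> leaves the filter proper, so by
      minimality \<open>U\<close> already contains it.\<close>
    let ?G = "inf U (principal {x. \<not> P x})"
    have "?G \<noteq> bot" using that by (simp add: trivial_limit_def eventually_inf_principal)
    then have "?G = U" using U by (intro min) (auto intro: le_infI1)
    moreover have "eventually (\<lambda>x. \<not> P x) ?G" by (simp add: eventually_inf_principal)
    ultimately show ?thesis by simp
  qed
  moreover have "\<not> eventually P U" if "eventually (\<lambda>x. \<not> P x) U" for P
    using that U(2) eventually_conj[of "\<lambda>x. \<not> P x" U P] by (auto simp: trivial_limit_def)
  ultimately have "\<not> eventually P U \<longleftrightarrow> eventually (\<lambda>x. \<not> P x) U" for P by blast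
  then show thesis by (rule that[OF U])
qed

text \<open>
  An elementary substructure of the ultrapower of \<open>N\<close> generated by (the classes of) \<open>B\<close>, copied to
  the type \<open>'u\<close>. It is closed under Skolem functions computed pointwise on representatives, so the
  ultrapower itself is never formed.
\<close>

lemma ultrapower_hull:
  fixes N :: "('f, 'r, 'a) fo_struct" and U :: "'i filter" and B :: "('i \<Rightarrow> 'a) set"
  assumes N: "is_structure N"
    and ultra: "\<And>P. \<not> eventually P U \<longleftrightarrow> eventually (\<lambda>i. \<not> P i) U"
    and B: "\<And>f. f \<in> B \<Longrightarrow> range f \<subseteq> carrier N"
    and inf: "infinite (UNIV :: 'u set)"
    and small: "{\<phi>. wf_fm (slang N) \<phi>} \<lesssim> (UNIV :: 'u set)" "B \<lesssim> (UNIV :: 'u set)"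
  obtains N' :: "('f, 'r, 'u) fo_struct" and c :: "('i \<Rightarrow> 'a) \<Rightarrow> 'u" where
    "is_structure N'" "slang N' = slang N" "c ` B \<subseteq> carrier N'"
    "\<And>\<phi>. wf_fm (slang N) \<phi> \<Longrightarrow> holds N \<phi> \<Longrightarrow> holds N' \<phi>"
    "\<And>\<phi> e. wf_fm (slang N) \<phi> \<Longrightarrow> range e \<subseteq> B \<Longrightarrow>
       sat N' (c \<circ> e) \<phi> \<longleftrightarrow> eventually (\<lambda>i. sat N (\<lambda>x. e x i) \<phi>) U"
proof -
  obtain a0 where a0: "a0 \<in> carrier N" using N unfolding is_structure_def by blast
  \<comment> \<open>Skolem function for \<open>Ex x \<psi>\<close>; the default \<open>a0\<close>
    keeps all values in the carrier.\<close>
  define witness where "witness x \<psi> e =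
    (if \<exists>a\<in>carrier N. sat N (e(x := a)) \<psi> then SOME a. a \<in> carrier N \<and> sat N (e(x := a)) \<psi> else a0)"
    for x \<psi> and e :: "nat \<Rightarrow> 'a"
  have witness: "sat N (e(x := witness x \<psi> e)) \<psi>" if "\<exists>a\<in>carrier N. sat N (e(x := a)) \<psi>" for x \<psi> e
    using someI_ex[of "\<lambda>a. a \<in> carrier N \<and> sat N (e(x := a)) \<psi>"] that
    unfolding witness_def by (simp add: Bex_def)
  have witness_in: "witness x \<psi> e \<in> carrier N" for x \<psi> e
    using someI_ex[of "\<lambda>a. a \<in> carrier N \<and> sat N (e(x := a)) \<psi>"] a0
    unfolding witness_def by (simp add: Bex_def)
  have witness_cong: "witness x \<psi> e = witness x \<psi> e'"
    if "\<And>y. y \<in> free_vars \<psi> \<Longrightarrow> e y = e' y" for x \<psi> and e e' :: "nat \<Rightarrow> 'a"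
  proof -
    have "sat N (e(x := a)) \<psi> \<longleftrightarrow> sat N (e'(x := a)) \<psi>" for a
      using that by (intro sat_cong) auto
    then show ?thesis by (simp add: witness_def)
  qed
  \<comment> \<open>Skolem functions take finite lists of representatives and work index by index;
    \<open>a0\<close> fills the variables beyond the list.\<close>
  define sk where "sk = (\<lambda>(x, \<psi>) fs (i :: 'i). witness x \<psi> (map (\<lambda>f. f i) fs \<frown> (\<lambda>_. a0)))"
  define F where "F = fin_closure B (sk ` (UNIV \<times> {\<psi>. wf_fm (slang N) \<psi>}))"
  have "F \<lesssim> (UNIV :: 'u set)"
    unfolding F_def
    by (rule fin_closure_lepoll[OF inf small(2) lepoll_trans[OF image_lepoll
          Times_lepoll_infinite[OF inf nat_lepoll_infinite[OF inf] small(1)]]])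
  then obtain j :: "('i \<Rightarrow> 'a) \<Rightarrow> 'u" where j: "inj_on j F" unfolding lepoll_def by blast
  have BF: "B \<subseteq> F" unfolding F_def by (auto intro: fin_closure.base)
  have F_sk: "sk (x, \<psi>) fs \<in> F" if "wf_fm (slang N) \<psi>" "set fs \<subseteq> F" for x \<psi> fs
    unfolding F_def
  proof (rule fin_closure.step)
    show "sk (x, \<psi>) \<in> sk ` (UNIV \<times> {\<psi>. wf_fm (slang N) \<psi>})" using that(1) by (intro imageI) simp
    show "f \<in> fin_closure B (sk ` (UNIV \<times> {\<psi>. wf_fm (slang N) \<psi>}))" if "f \<in> set fs" for f
      using that \<open>set fs \<subseteq> F\<close> unfolding F_def by (rule subsetD[rotated])
  qed
  have F_carrier: "f i \<in> carrier N" if "f \<in> F" for f i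
    using that unfolding F_def
  proof (cases rule: fin_closure.cases)
    case base
    then show ?thesis using B by blast
  next
    case (step op xs)
    then obtain x \<psi> where "op = sk (x, \<psi>)" by (elim imageE SigmaE) simp
    then show ?thesis using step(1) witness_in by (simp add: sk_def)
  qed
  \<comment> \<open>\<open>B\<close> may be empty, so a Skolem function without arguments provides
    an element of the hull.\<close>
  have "sk (0, Eq (Var 0) (Var 0)) [] \<in> F" by (rule F_sk) auto
  then obtain f0 where f0: "f0 \<in> F" by blast
  have F_witness: "(\<lambda>i. witness x \<psi> (\<lambda>y. e y i)) \<in> F"
    if \<psi>: "wf_fm (slang N) \<psi>" and e: "range e \<subseteq> F" for x \<psi> e
  proof -
    obtain K where K: "\<And>y. y \<in> free_vars \<psi> \<Longrightarrow> y < K" using free_vars_bound by blast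
    \<comment> \<open>The list up to \<open>K\<close> covers the free variables of
      \<open>\<psi>\<close>, so padding with \<open>a0\<close> makes no difference.\<close>
    have "sk (x, \<psi>) (map e [0..<K]) = (\<lambda>i. witness x \<psi> (\<lambda>y. e y i))"
      unfolding sk_def prod.case by (intro ext witness_cong) (auto dest: K)
    moreover have "sk (x, \<psi>) (map e [0..<K]) \<in> F" using e by (intro F_sk \<psi>) auto
    ultimately show ?thesis by simp
  qed
  have F_fun: "(\<lambda>i. fun_int N f (map (\<lambda>g. g i) gs)) \<in> F"
    if f: "(f, length gs) \<in> funs (slang N)" and gs: "set gs \<subseteq> F" for f gs
  proof -
    let ?n = "length gs" and ?e = "gs \<frown> (\<lambda>_. f0)"
    \<comment> \<open>The function value is the only witness for this formula, so closure under
      Skolem functions yields closure under \<open>f\<close>.\<close>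
    let ?\<psi> = "Eq (Var ?n) (Fn f (map Var [0..<?n])) :: ('f, 'r) fm"
    have sat: "sat N ((\<lambda>y. ?e y i)(?n := a)) ?\<psi> \<longleftrightarrow> a = fun_int N f (map (\<lambda>g. g i) gs)" for i a
    proof -
      have "map (eval_trm N ((\<lambda>y. ?e y i)(?n := a))) (map Var [0..<?n]) = map (\<lambda>g. g i) gs"
        by (rule nth_equalityI) simp_all
      then show ?thesis by (simp del: map_map)
    qed
    have "witness ?n ?\<psi> (\<lambda>y. ?e y i) = fun_int N f (map (\<lambda>g. g i) gs)" for i
    proof -
      have "fun_int N f (map (\<lambda>g. g i) gs) \<in> carrier N"
        using gs F_carrier by (intro fun_int_in_carrier[OF N]) (auto simp: f)
      then show ?thesis using witness[of "\<lambda>y. ?e y i" ?n ?\<psi>] unfolding sat by blast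
    qed
    moreover have "wf_fm (slang N) ?\<psi>" using f by (simp add: list_all_iff)
    moreover have "range ?e \<subseteq> F" using gs f0 by auto
    ultimately show ?thesis using F_witness[of ?\<psi> ?e ?n] by simp
  qed
  define eq where "eq f g \<longleftrightarrow> eventually (\<lambda>i. f i = g i) U" for f g :: "'i \<Rightarrow> 'a"
  have eq_refl: "eq f f" for f by (simp add: eq_def)
  have eq_sym: "eq g f" if "eq f g" for f g using that by (simp add: eq_def eq_commute)
  have eq_trans: "eq f h" if "eq f g" "eq g h" for f g h
    using that unfolding eq_def by eventually_elim simp
  \<comment> \<open>The choice depends only on the class of \<open>f\<close> modulo
    \<open>U\<close>, so \<open>c\<close> is constant on classes; \<open>j\<close> transports the
    chosen representative to \<open>'u\<close>.\<close>
  define c where "c f = j (SOME g. g \<in> F \<and> eq g f)" for f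
  have c_eq: "c f = c g \<longleftrightarrow> eq f g" if "f \<in> F" "g \<in> F" for f g
  proof
    assume "eq f g"
    then have "eq h f \<longleftrightarrow> eq h g" for h
      using eq_trans[of h f g] eq_trans[of h g f] eq_sym[of f g] by blast
    then show "c f = c g" by (simp add: c_def)
  next
    have some: "(SOME h. h \<in> F \<and> eq h f) \<in> F \<and> eq (SOME h. h \<in> F \<and> eq h f) f" if "f \<in> F" for f
      using that eq_refl by (rule someI[of "\<lambda>h. h \<in> F \<and> eq h f" f, OF conjI])
    assume "c f = c g"
    then have "(SOME h. h \<in> F \<and> eq h f) = (SOME h. h \<in> F \<and> eq h g)"
      using inj_onD[OF j] some[OF \<open>f \<in> F\<close>] some[OF \<open>g \<in> F\<close>] unfolding c_def by blast
    then show "eq f g"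
      using some[OF \<open>f \<in> F\<close>] some[OF \<open>g \<in> F\<close>] eq_trans[OF eq_sym] by metis
  qed
  \<comment> \<open>A representative in \<open>F\<close> for each element; it agrees with other
    representatives only \<open>U\<close>-almost everywhere.\<close>
  define d where "d = inv_into F c"
  have d: "d a \<in> F" "c (d a) = a" if "a \<in> c ` F" for a
    using that by (auto simp: d_def inv_into_into f_inv_into_f)
  have dc: "eq (d (c f)) f" if "f \<in> F" for f
    using that d[of "c f"] c_eq by blast
  have dc_list: "eventually (\<lambda>i. map (\<lambda>a. d a i) (map c fs) = map (\<lambda>f. f i) fs) U" if "set fs \<subseteq> F" for fs
  proof -
    have "eventually (\<lambda>i. \<forall>f\<in>set fs. d (c f) i = f i) U"
      using that dc by (intro eventually_ball_finite) (auto simp: eq_def)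
    then show ?thesis by eventually_elim simp
  qed
  \<comment> \<open>Symbols are evaluated on the representatives \<open>d a\<close>; by
    \<open>dc_list\<close>, other representatives in \<open>F\<close> lead to the same
    result.\<close>
  define N' where "N' = \<lparr>slang = slang N, carrier = c ` F,
    fun_int = (\<lambda>f as. c (\<lambda>i. fun_int N f (map (\<lambda>a. d a i) as))),
    rel_int = (\<lambda>r as. eventually (\<lambda>i. rel_int N r (map (\<lambda>a. d a i) as)) U)\<rparr>"
  have N'_simps [simp]: "slang N' = slang N" "carrier N' = c ` F"
    "fun_int N' f as = c (\<lambda>i. fun_int N f (map (\<lambda>a. d a i) as))"
    "rel_int N' r as \<longleftrightarrow> eventually (\<lambda>i. rel_int N r (map (\<lambda>a. d a i) as)) U" for f r as
    by (simp_all add: N'_def)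
  have N': "is_structure N'"
    unfolding is_structure_def
  proof (intro conjI ballI, goal_cases)
    case 1
    then show ?case using f0 by auto
  next
    case (2 fm)
    obtain f m where fm: "fm = (f, m)" by (cases fm)
    have "fun_int N' f as \<in> carrier N'" if "length as = m" "set as \<subseteq> carrier N'" for as
    proof -
      have "(\<lambda>i. fun_int N f (map (\<lambda>g. g i) (map d as))) \<in> F"
        using 2 that d(1) fm by (intro F_fun) auto
      then show ?thesis by (simp add: comp_def)
    qed
    then show ?case by (simp add: fm)
  qed
  have trm: "(\<lambda>i. eval_trm N (\<lambda>x. e x i) t) \<in> F \<and>
      eval_trm N' (c \<circ> e) t = c (\<lambda>i. eval_trm N (\<lambda>x. e x i) t)"
    if e: "range e \<subseteq> F" and "wf_trm (slang N) t" for e t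
    using that(2)
  proof (induction t)
    case (Var x)
    then show ?case using e by auto
  next
    case (Fn f ts)
    define gs where "gs = map (\<lambda>t i. eval_trm N (\<lambda>x. e x i) t) ts"
    have ts: "\<And>t. t \<in> set ts \<Longrightarrow> wf_trm (slang N) t" and f: "(f, length gs) \<in> funs (slang N)"
      using Fn.prems by (auto simp: list_all_iff gs_def)
    have IH: "(\<lambda>i. eval_trm N (\<lambda>x. e x i) t) \<in> F"
      "eval_trm N' (c \<circ> e) t = c (\<lambda>i. eval_trm N (\<lambda>x. e x i) t)" if "t \<in> set ts" for t
      using Fn.IH[OF that ts[OF that]] by blast+
    have gs: "set gs \<subseteq> F" using IH(1) by (auto simp: gs_def)
    have eval_ts: "map (eval_trm N' (c \<circ> e)) ts = map c gs"
      unfolding gs_def map_map by (rule map_cong[OF refl]) (simp only: comp_apply IH(2))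
    have gs_i: "map (eval_trm N (\<lambda>x. e x i)) ts = map (\<lambda>g. g i) gs" for i by (simp add: gs_def)
    have F1: "(\<lambda>i. fun_int N f (map (\<lambda>g. g i) gs)) \<in> F" by (rule F_fun[OF f gs])
    have "set (map (\<lambda>g. d (c g)) gs) \<subseteq> F" using gs d(1) by auto
    from F_fun[OF _ this, of f] f
    have F2: "(\<lambda>i. fun_int N f (map (\<lambda>a. d a i) (map c gs))) \<in> F" by (simp add: comp_def)
    have "eq (\<lambda>i. fun_int N f (map (\<lambda>a. d a i) (map c gs))) (\<lambda>i. fun_int N f (map (\<lambda>g. g i) gs))"
      unfolding eq_def using dc_list[OF gs] by eventually_elim (simp only:)
    then have "c (\<lambda>i. fun_int N f (map (\<lambda>a. d a i) (map c gs))) = c (\<lambda>i. fun_int N f (map (\<lambda>g. g i) gs))"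
      using c_eq[OF F2 F1] by blast
    then show ?case unfolding eval_trm.simps N'_simps eval_ts gs_i using F1 by blast
  qed
  \<comment> \<open>Theorem of Los for the hull: negation uses the ultrafilter property, the
    quantifier uses closure under Skolem functions.\<close>
  have sat: "sat N' (c \<circ> e) \<phi> \<longleftrightarrow> eventually (\<lambda>i. sat N (\<lambda>x. e x i) \<phi>) U"
    if "wf_fm (slang N) \<phi>" "range e \<subseteq> F" for e \<phi>
    using that
  proof (induction \<phi> arbitrary: e)
    case (Eq s t)
    then have "wf_trm (slang N) s" "wf_trm (slang N) t" by auto
    note s = trm[OF Eq.prems(2) this(1)] and t = trm[OF Eq.prems(2) this(2)]
    show ?case
      unfolding sat.simps conjunct2[OF s] conjunct2[OF t]
      by (rule c_eq[OF conjunct1[OF s] conjunct1[OF t], unfolded eq_def])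
  next
    case (Rel r ts)
    define gs where "gs = map (\<lambda>t i. eval_trm N (\<lambda>x. e x i) t) ts"
    have wf: "\<And>t. t \<in> set ts \<Longrightarrow> wf_trm (slang N) t" using Rel.prems by (simp add: list_all_iff)
    have gs: "set gs \<subseteq> F" using trm[OF Rel.prems(2) wf] by (auto simp: gs_def)
    have eval_ts: "map (eval_trm N' (c \<circ> e)) ts = map c gs"
      unfolding gs_def map_map
      by (rule map_cong[OF refl]) (simp only: comp_apply trm[OF Rel.prems(2) wf])
    have gs_i: "map (eval_trm N (\<lambda>x. e x i)) ts = map (\<lambda>g. g i) gs" for i by (simp add: gs_def)
    have "eventually (\<lambda>i. rel_int N r (map (\<lambda>a. d a i) (map c gs)) \<longleftrightarrow>
        rel_int N r (map (\<lambda>g. g i) gs)) U"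
      using dc_list[OF gs] by eventually_elim (simp only:)
    then show ?case unfolding sat.simps N'_simps eval_ts gs_i by (rule eventually_subst)
  next
    case (Neg \<phi>)
    then show ?case using ultra by simp
  next
    case (Conj \<phi> \<psi>)
    then show ?case by (simp add: eventually_conj_iff)
  next
    case (Ex x \<phi>)
    then have \<phi>: "wf_fm (slang N) \<phi>" by simp
    have IH: "sat N' ((c \<circ> e)(x := c f)) \<phi> \<longleftrightarrow>
        eventually (\<lambda>i. sat N ((\<lambda>y. e y i)(x := f i)) \<phi>) U" if "f \<in> F" for f
    proof -
      have "(c \<circ> e)(x := c f) = c \<circ> e(x := f)" by auto
      moreover have "(\<lambda>y. e y i)(x := f i) = (\<lambda>y. (e(x := f)) y i)" for i by auto
      moreover have "range (e(x := f)) \<subseteq> F" using Ex.prems(2) that by auto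
      ultimately show ?thesis using Ex.IH[OF \<phi>, of "e(x := f)"] by (simp only:)
    qed
    show ?case
    proof
      assume "sat N' (c \<circ> e) (Ex x \<phi>)"
      then obtain f where f: "f \<in> F" "sat N' ((c \<circ> e)(x := c f)) \<phi>" by auto
      then have "eventually (\<lambda>i. sat N ((\<lambda>y. e y i)(x := f i)) \<phi>) U" using IH by blast
      then show "eventually (\<lambda>i. sat N (\<lambda>y. e y i) (Ex x \<phi>)) U"
        unfolding sat.simps by (rule eventually_mono) (use F_carrier[OF f(1)] in blast)
    next
      \<comment> \<open>Witnesses are chosen index by index, and the resulting function stays in
        \<open>F\<close>.\<close>
      define f where "f i = witness x \<phi> (\<lambda>y. e y i)" for i
      have f: "f \<in> F" unfolding f_def by (rule F_witness[OF \<phi> Ex.prems(2)])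
      assume "eventually (\<lambda>i. sat N (\<lambda>y. e y i) (Ex x \<phi>)) U"
      then have "eventually (\<lambda>i. sat N ((\<lambda>y. e y i)(x := f i)) \<phi>) U"
        unfolding f_def by eventually_elim (simp add: witness)
      then have "sat N' ((c \<circ> e)(x := c f)) \<phi>" using IH[OF f] by blast
      then show "sat N' (c \<circ> e) (Ex x \<phi>)" using f by auto
    qed
  qed
  show thesis
  proof (rule that[OF N'])
    show "c ` B \<subseteq> carrier N'" using BF by auto
    show "sat N' (c \<circ> e) \<phi> \<longleftrightarrow> eventually (\<lambda>i. sat N (\<lambda>x. e x i) \<phi>) U"
      if "wf_fm (slang N) \<phi>" "range e \<subseteq> B" for \<phi> e
      using that BF by (intro sat) auto
    show "holds N' \<phi>" if \<phi>: "wf_fm (slang N) \<phi>" and "holds N \<phi>" for \<phi>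
      unfolding holds_def
    proof (intro allI impI)
      fix e :: "nat \<Rightarrow> 'u" assume e: "range e \<subseteq> carrier N'"
      then have e_in: "e x \<in> c ` F" for x by auto
      have dF: "range (d \<circ> e) \<subseteq> F" and cd: "c \<circ> (d \<circ> e) = e"
        using d[OF e_in] by (auto simp: fun_eq_iff)
      \<comment> \<open>Every assignment into \<open>N'\<close> has representatives, and
        \<open>\<phi>\<close> is true of them at every index.\<close>
      have "sat N (\<lambda>x. (d \<circ> e) x i) \<phi>" for i
      proof -
        have "range (\<lambda>x. (d \<circ> e) x i) \<subseteq> carrier N"
          by (rule image_subsetI) (rule F_carrier[OF subsetD[OF dF rangeI]])
        then show ?thesis using \<open>holds N \<phi>\<close> unfolding holds_def by simp
      qed
      then have "sat N' (c \<circ> (d \<circ> e)) \<phi>" unfolding sat[OF \<phi> dF] by simp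
      then show "sat N' e \<phi>" unfolding cd .
    qed
  qed simp
qed

section \<open>Finite realisations and the ultrafilter on the index set\<close>

lemma sat_foldr_Ex_intro:
  assumes "range e \<subseteq> carrier M" "sat M e \<phi>"
  shows "sat M e (foldr Ex xs \<phi>)"
proof (induction xs)
  case (Cons x xs)
  then have "sat M (e(x := e x)) (foldr Ex xs \<phi>)" by simp
  moreover have "e x \<in> carrier M" using assms(1) by blast
  ultimately show ?case by (auto simp del: fun_upd_triv)
qed (simp add: assms)

lemma sat_foldr_Ex_elim:
  assumes "range e \<subseteq> carrier M" "sat M e (foldr Ex xs \<phi>)"
  shows "\<exists>e'. range e' \<subseteq> carrier M \<and> sat M e' \<phi>"
  using assms
proof (induction xs arbitrary: e)
  case (Cons x xs)
  then obtain a where "a \<in> carrier M" "sat M (e(x := a)) (foldr Ex xs \<phi>)" by auto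
  moreover from this have "range (e(x := a)) \<subseteq> carrier M" using Cons.prems(1) by auto
  ultimately show ?case by (intro Cons.IH)
qed auto

lemma free_vars_foldr_Ex: "free_vars (foldr Ex xs \<phi>) = free_vars \<phi> - set xs"
  by (induction xs) auto

lemma wf_foldr_Ex: "wf_fm L (foldr Ex xs \<phi>) \<longleftrightarrow> wf_fm L \<phi>"
  by (induction xs) auto

lemma sentence_sat_holds:
  fixes M :: "('a, 'b, 'c) fo_struct"
  assumes "sentence L \<phi>" "sat M e \<phi>"
  shows "holds M \<phi>"
  unfolding holds_def
proof (intro allI impI)
  fix e' :: "nat \<Rightarrow> 'c"
  show "sat M e' \<phi>" using assms sat_cong[of \<phi> e e' M] by (simp add: sentence_def)
qed

text \<open>The existential closure of \<open>\<phi>\<close>, joined with the equalities among the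
  relevant values of \<open>e\<close>, is a sentence true in \<open>M'\<close> and hence in
  \<open>M\<close>; its witnesses prescribe \<open>g\<close> at finitely many elements.\<close>

lemma realize_in_equivalent:
  fixes M :: "('g, 's, 'b) fo_struct" and M' :: "('g, 's, 'u) fo_struct"
  assumes M: "is_structure M" and lang: "slang M' = slang M"
    and equiv: "\<And>\<phi>. sentence (slang M) \<phi> \<Longrightarrow> holds M' \<phi> \<Longrightarrow> holds M \<phi>"
    and \<phi>: "wf_fm (slang M) \<phi>" and e: "range e \<subseteq> carrier M'" and sat: "sat M' e \<phi>"
  shows "\<exists>g. range g \<subseteq> carrier M \<and> sat M (g \<circ> e) \<phi>"
proof -
  obtain b0 where b0: "b0 \<in> carrier M" using M unfolding is_structure_def by blast
  obtain K where K: "\<And>x. x \<in> free_vars \<phi> \<Longrightarrow> x < K" using free_vars_bound by blast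
  \<comment> \<open>Equal values of \<open>e\<close> must be realised by equal values for \<open>g\<close> to be well defined.\<close>
  define xys where "xys = filter (\<lambda>(x, y). e x = e y) (List.product [0..<K] [0..<K])"
  have xys: "set xys = {(x, y). x < K \<and> y < K \<and> e x = e y}" by (auto simp: xys_def)
  define \<chi> where "\<chi> = foldr (\<lambda>(x, y). Conj (Eq (Var x) (Var y))) xys \<phi>"
  have sat_\<chi>: "sat A f \<chi> \<longleftrightarrow> (\<forall>(x, y)\<in>set xys. f x = f y) \<and> sat A f \<phi>"
    for A :: "('g, 's, 'c) fo_struct" and f
    unfolding \<chi>_def by (induction xys) auto
  have "wf_fm (slang M) \<chi>" using \<phi> unfolding \<chi>_def by (induction xys) auto
  moreover have "free_vars \<chi> = free_vars \<phi> \<union> (\<Union>(x, y)\<in>set xys. {x, y})"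
    unfolding \<chi>_def by (induction xys) auto
  then have "free_vars \<chi> \<subseteq> {..<K}" using K by (auto simp: xys)
  ultimately have sentence: "sentence (slang M) (foldr Ex [0..<K] \<chi>)"
    by (auto simp: sentence_def wf_foldr_Ex free_vars_foldr_Ex)
  have "sat M' e \<chi>" unfolding sat_\<chi> using sat by (simp add: xys)
  from sat_foldr_Ex_intro[OF e this] have "holds M' (foldr Ex [0..<K] \<chi>)"
    by (rule sentence_sat_holds[OF sentence])
  then have "holds M (foldr Ex [0..<K] \<chi>)" by (rule equiv[OF sentence])
  moreover have b0': "range (\<lambda>_::nat. b0) \<subseteq> carrier M" using b0 by auto
  ultimately have "sat M (\<lambda>_. b0) (foldr Ex [0..<K] \<chi>)" unfolding holds_def by simp
  from sat_foldr_Ex_elim[OF b0' this] obtain f where f: "range f \<subseteq> carrier M" "sat M f \<chi>"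
    by blast
  \<comment> \<open>The value of a variable below \<open>K\<close> is sent to the witness for it;
    \<open>b0\<close> serves all other elements.\<close>
  define g where "g u = (if \<exists>x<K. e x = u then f (SOME x. x < K \<and> e x = u) else b0)" for u
  have "g (e x) = f x" if "x < K" for x
  proof -
    have "(SOME y. y < K \<and> e y = e x) < K \<and> e (SOME y. y < K \<and> e y = e x) = e x"
      using that someI[of "\<lambda>y. y < K \<and> e y = e x" x] by blast
    then have "(SOME y. y < K \<and> e y = e x, x) \<in> set xys" using that by (simp add: xys)
    then have "f (SOME y. y < K \<and> e y = e x) = f x" using f(2) unfolding sat_\<chi> by blast
    moreover have "\<exists>y<K. e y = e x" using that by blast
    ultimately show ?thesis unfolding g_def by simp
  qed
  then have "sat M (g \<circ> e) \<phi> \<longleftrightarrow> sat M f \<phi>" by (intro sat_cong) (simp add: K)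
  then have "sat M (g \<circ> e) \<phi>" using f(2) unfolding sat_\<chi> by simp
  moreover have "range g \<subseteq> carrier M"
  proof (rule image_subsetI)
    show "g u \<in> carrier M" for u using f(1) b0 unfolding g_def by (cases "\<exists>x<K. e x = u") auto
  qed
  ultimately show ?thesis by (intro exI[of _ g] conjI)
qed

text \<open>The sets of maps realising a formula true in \<open>M'\<close> form a filter base; an
  ultrafilter containing them also handles false formulas, through their negations.\<close>

lemma ultrafilter_of_realizations:
  fixes M :: "('g, 's, 'b) fo_struct" and M' :: "('g, 's, 'u) fo_struct" and r :: "'b \<Rightarrow> 'b"
  assumes M: "is_structure M" and lang: "slang M' = slang M"
    and equiv: "\<And>\<phi>. sentence (slang M) \<phi> \<Longrightarrow> holds M' \<phi> \<Longrightarrow> holds M \<phi>"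
    and r: "\<And>b. b \<in> carrier M \<Longrightarrow> r b = b"
    and M': "is_structure M'"
  obtains U :: "('u \<Rightarrow> 'b) filter" where
    "\<And>P. \<not> eventually P U \<longleftrightarrow> eventually (\<lambda>g. \<not> P g) U"
    "\<And>\<phi> e. wf_fm (slang M) \<phi> \<Longrightarrow> range e \<subseteq> carrier M' \<Longrightarrow>
       eventually (\<lambda>g. sat M (r \<circ> g \<circ> e) \<phi>) U \<longleftrightarrow> sat M' e \<phi>"
proof -
  define \<S> where "\<S> = {{g. sat M (r \<circ> g \<circ> e) \<phi>} | \<phi> e.
    wf_fm (slang M) \<phi> \<and> range e \<subseteq> carrier M' \<and> sat M' e \<phi>}"
  have \<S>_I: "{g. sat M (r \<circ> g \<circ> e) \<phi>} \<in> \<S>"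
    if "wf_fm (slang M) \<phi>" "range e \<subseteq> carrier M'" "sat M' e \<phi>" for \<phi> e
    using that unfolding \<S>_def by blast
  obtain u0 where u0: "u0 \<in> carrier M'" using M' unfolding is_structure_def by blast
  have "{g. sat M (r \<circ> g \<circ> (\<lambda>_. u0)) (Eq (Var 0) (Var 0))} \<in> \<S>"
    by (rule \<S>_I) (use u0 in auto)
  then have "\<S> \<noteq> {}" by blast
  have inter: "A \<inter> B \<in> \<S>" if AB: "A \<in> \<S>" "B \<in> \<S>" for A B
  proof -
    obtain \<phi> e where \<phi>: "wf_fm (slang M) \<phi>" "range e \<subseteq> carrier M'" "sat M' e \<phi>"
      and A: "A = {g. sat M (r \<circ> g \<circ> e) \<phi>}" using AB(1) unfolding \<S>_def by blast
    obtain \<psi> f where \<psi>: "wf_fm (slang M) \<psi>" "range f \<subseteq> carrier M'" "sat M' f \<psi>"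
      and B: "B = {g. sat M (r \<circ> g \<circ> f) \<psi>}" using AB(2) unfolding \<S>_def by blast
    obtain K where K: "\<And>x. x \<in> free_vars \<phi> \<Longrightarrow> x < K" using free_vars_bound by blast
    \<comment> \<open>The variables of \<open>\<psi>\<close> are moved beyond \<open>K\<close>, so
      that one assignment carries both \<open>e\<close> and \<open>f\<close>.\<close>
    let ?e = "map e [0..<K] \<frown> f" and ?\<chi> = "Conj \<phi> (rename \<psi> (\<lambda>x. x + K))"
    have sat: "sat L (h \<circ> ?e) ?\<chi> \<longleftrightarrow> sat L (h \<circ> e) \<phi> \<and> sat L (h \<circ> f) \<psi>"
      for L :: "('g, 's, 'c) fo_struct" and h
    proof -
      have "sat L (h \<circ> ?e) \<phi> \<longleftrightarrow> sat L (h \<circ> e) \<phi>" by (rule sat_cong) (simp add: K)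
      moreover have "h \<circ> ?e \<circ> (\<lambda>x. x + K) = h \<circ> f" by auto
      ultimately show ?thesis by simp
    qed
    have AB_eq: "A \<inter> B = {g. sat M (r \<circ> g \<circ> ?e) ?\<chi>}"
      unfolding A B sat by blast
    show ?thesis
      unfolding AB_eq
    proof (rule \<S>_I)
      show "sat M' ?e ?\<chi>" using sat[of M' id] \<phi>(3) \<psi>(3) unfolding id_comp by blast
      show "wf_fm (slang M) ?\<chi>" using \<phi>(1) \<psi>(1) by simp
      show "range ?e \<subseteq> carrier M'" using \<phi>(2) \<psi>(2) by auto
    qed
  qed
  \<comment> \<open>Closure under intersection makes the principal filters a base, so eventually
    means on some member of \<open>\<S>\<close>.\<close>
  have ev: "eventually P (Inf (principal ` \<S>)) \<longleftrightarrow> (\<exists>A\<in>\<S>. \<forall>g\<in>A. P g)" for P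
  proof -
    have "eventually P (Inf (principal ` \<S>)) \<longleftrightarrow> (\<exists>F\<in>principal ` \<S>. eventually P F)"
    proof (rule eventually_Inf_base)
      fix F G assume "F \<in> principal ` \<S>" "G \<in> principal ` \<S>"
      then obtain A B where "A \<in> \<S>" "F = principal A" "B \<in> \<S>" "G = principal B" by blast
      then show "\<exists>H\<in>principal ` \<S>. H \<le> inf F G"
        using imageI[OF inter, of A B principal] by (intro bexI[of _ "principal (A \<inter> B)"]) auto
    qed (use \<open>\<S> \<noteq> {}\<close> in simp)
    then show ?thesis by (simp add: eventually_principal)
  qed
  have "A \<noteq> {}" if "A \<in> \<S>" for A
  proof -
    obtain \<phi> e where \<phi>: "wf_fm (slang M) \<phi>" "range e \<subseteq> carrier M'" "sat M' e \<phi>"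
      and A: "A = {g. sat M (r \<circ> g \<circ> e) \<phi>}" using \<open>A \<in> \<S>\<close> unfolding \<S>_def by blast
    obtain g where g: "range g \<subseteq> carrier M" "sat M (g \<circ> e) \<phi>"
      using realize_in_equivalent[OF M lang equiv \<phi>] by blast
    have "r \<circ> g = g" using g(1) r by (auto simp: fun_eq_iff)
    then have "sat M (r \<circ> g \<circ> e) \<phi>" using g(2) by simp
    then show ?thesis unfolding A by blast
  qed
  then have "Inf (principal ` \<S>) \<noteq> bot" unfolding trivial_limit_def ev by blast
  then obtain U where U: "U \<le> Inf (principal ` \<S>)" "U \<noteq> bot"
    and ultra: "\<And>P. \<not> eventually P U \<longleftrightarrow> eventually (\<lambda>g. \<not> P g) U"
    by (rule ultrafilter_exists) blast
  have *: "eventually (\<lambda>g. sat M (r \<circ> g \<circ> e) \<phi>) U"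
    if "wf_fm (slang M) \<phi>" "range e \<subseteq> carrier M'" "sat M' e \<phi>" for \<phi> e
  proof (rule filter_leD[OF U(1)])
    show "eventually (\<lambda>g. sat M (r \<circ> g \<circ> e) \<phi>) (Inf (principal ` \<S>))"
      unfolding ev by (rule bexI[OF _ \<S>_I[OF that]]) blast
  qed
  show thesis
  proof (rule that[OF ultra])
    fix \<phi> :: "('g, 's) fm" and e :: "nat \<Rightarrow> 'u" assume \<phi>: "wf_fm (slang M) \<phi>" "range e \<subseteq> carrier M'"
    show "eventually (\<lambda>g. sat M (r \<circ> g \<circ> e) \<phi>) U \<longleftrightarrow> sat M' e \<phi>"
    proof (cases "sat M' e \<phi>")
      case True
      then show ?thesis using *[OF \<phi>] by blast
    next
      case False
      then have "eventually (\<lambda>g. \<not> sat M (r \<circ> g \<circ> e) \<phi>) U"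
        using *[of "Neg \<phi>" e] \<phi> by simp
      then show ?thesis
        using False ultra[of "\<lambda>g. sat M (r \<circ> g \<circ> e) \<phi>"] by simp
    qed
  qed
qed

section \<open>Trace definability\<close>

text \<open>An element \<open>u\<close> is coded by the classes of
  \<open>g \<mapsto> s (r (g u)) ! j\<close>. By the theorem of Los a translated formula holds of
  such codes iff \<open>\<phi>\<close> holds of \<open>r \<circ> g \<circ> e\<close> for
  \<open>U\<close>-almost all \<open>g\<close>, which by the choice of \<open>U\<close> means that
  \<open>\<phi>\<close> holds of \<open>e\<close> in \<open>M'\<close>.\<close>

lemma formula_coding_transfer:
  fixes N :: "('f, 'r, 'a) fo_struct" and M :: "('g, 's, 'b) fo_struct"
    and M' :: "('g, 's, 'u) fo_struct"
  assumes N: "is_structure N" and M: "is_structure M" and M': "is_structure M'"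
    and lang: "slang M' = slang M"
    and equiv: "\<And>\<phi>. sentence (slang M) \<phi> \<Longrightarrow> holds M' \<phi> \<Longrightarrow> holds M \<phi>"
    and coding: "formula_coding N M k s"
    and univ: "adequate_universe TYPE('u) (slang N)" "adequate_universe TYPE('u) (slang M)"
  obtains N' :: "('f, 'r, 'u) fo_struct" and s' where "is_structure N'" "slang N' = slang N"
    "\<And>\<phi>. wf_fm (slang N) \<phi> \<Longrightarrow> holds N \<phi> \<Longrightarrow> holds N' \<phi>" "formula_coding N' M' k s'"
proof -
  have inf: "infinite (UNIV :: 'u set)"
    and small: "{\<phi>. wf_fm (slang N) \<phi>} \<lesssim> (UNIV :: 'u set)" "{\<phi>. wf_fm (slang M) \<phi>} \<lesssim> (UNIV :: 'u set)"
    using univ wf_fm_lepoll unfolding adequate_universe_def by blast+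
  have k: "k \<ge> 1" and s: "s ` carrier M \<subseteq> tuples N k"
    using coding unfolding formula_coding_def by blast+
  obtain \<psi> ps where \<psi>: "\<And>\<phi>. wf_fm (slang M) \<phi> \<Longrightarrow> wf_fm (slang N) (\<psi> \<phi>)"
    and ps: "\<And>\<phi>. wf_fm (slang M) \<phi> \<Longrightarrow> set (ps \<phi>) \<subseteq> carrier N"
    and sat: "\<And>\<phi> e. wf_fm (slang M) \<phi> \<Longrightarrow> range e \<subseteq> carrier M \<Longrightarrow>
      sat M e \<phi> \<longleftrightarrow> sat N (ps \<phi> \<frown> flat k s e) (\<psi> \<phi>)"
    using coding unfolding formula_coding_def by metis
  obtain b0 where b0: "b0 \<in> carrier M" using M unfolding is_structure_def by blast
  \<comment> \<open>The index set consists of all maps \<open>'u \<Rightarrow> 'b\<close>; \<open>r\<close> retracts their values to \<open>M\<close>.\<close>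
  define r where "r b = (if b \<in> carrier M then b else b0)" for b
  have r: "r b \<in> carrier M" for b using b0 by (simp add: r_def)
  have r_id: "r b = b" if "b \<in> carrier M" for b using that by (simp add: r_def)
  obtain U :: "('u \<Rightarrow> 'b) filter" where
    ultra: "\<And>P. \<not> eventually P U \<longleftrightarrow> eventually (\<lambda>g. \<not> P g) U"
    and U: "\<And>\<phi> e. wf_fm (slang M) \<phi> \<Longrightarrow> range e \<subseteq> carrier M' \<Longrightarrow>
       eventually (\<lambda>g. sat M (r \<circ> g \<circ> e) \<phi>) U \<longleftrightarrow> sat M' e \<phi>"
    using ultrafilter_of_realizations[OF M lang equiv r_id M'] by blast
  define coord where "coord u j g = s (r (g u)) ! j" for u :: 'u and j and g :: "'u \<Rightarrow> 'b"
  \<comment> \<open>Parameters from \<open>N\<close> enter as constant functions, finitely many for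
    each formula of \<open>M\<close>, so \<open>'u\<close> bounds their number.\<close>
  define params where "params = (\<Union>\<phi>\<in>{\<phi>. wf_fm (slang M) \<phi>}. (\<lambda>p (g :: 'u \<Rightarrow> 'b). p) ` set (ps \<phi>))"
  define B where "B = (\<lambda>(u, j). coord u j) ` (UNIV \<times> {..<k}) \<union> params"
  have s_r: "length (s (r b)) = k" "set (s (r b)) \<subseteq> carrier N" for b
    using s r[of b] by (auto simp: tuples_def)
  have B_carrier: "range f \<subseteq> carrier N" if "f \<in> B" for f
    using that unfolding B_def
  proof
    assume "f \<in> (\<lambda>(u, j). coord u j) ` (UNIV \<times> {..<k})"
    then obtain u j where "f = coord u j" "j < k" by auto
    then show ?thesis using s_r nth_mem by (fastforce simp: coord_def)
  next
    assume "f \<in> params"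
    then show ?thesis using ps by (auto simp: params_def)
  qed
  have "params \<lesssim> (UNIV :: 'u set)"
    unfolding params_def
    by (intro UN_lepoll_infinite[OF inf small(2)] finite_lepoll_infinite[OF inf]) simp
  then have B_small: "B \<lesssim> (UNIV :: 'u set)"
    unfolding B_def
    by (intro Un_lepoll_infinite[OF inf] lepoll_trans[OF image_lepoll]
        Times_lepoll_infinite[OF inf] nat_lepoll_infinite[OF inf] lepoll_refl)
  obtain N' :: "('f, 'r, 'u) fo_struct" and c where N': "is_structure N'" "slang N' = slang N"
    and cB: "c ` B \<subseteq> carrier N'"
    and holds: "\<And>\<phi>. wf_fm (slang N) \<phi> \<Longrightarrow> holds N \<phi> \<Longrightarrow> holds N' \<phi>"
    and los: "\<And>\<phi> e. wf_fm (slang N) \<phi> \<Longrightarrow> range e \<subseteq> B \<Longrightarrow>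
       sat N' (c \<circ> e) \<phi> \<longleftrightarrow> eventually (\<lambda>i. sat N (\<lambda>x. e x i) \<phi>) U"
    by (rule ultrapower_hull[OF N ultra B_carrier inf small(1) B_small], assumption, rule that)
  define s' where "s' u = map (\<lambda>j. c (coord u j)) [0..<k]" for u
  have coord_B: "coord u j \<in> B" if "j < k" for u j
    using that unfolding B_def by force
  have s': "s' u \<in> tuples N' k" for u
    using cB coord_B by (auto simp: s'_def tuples_def)
  have "\<exists>\<chi> qs. wf_fm (slang N') \<chi> \<and> set qs \<subseteq> carrier N' \<and>
      (\<forall>e. range e \<subseteq> carrier M' \<longrightarrow> (sat M' e \<phi> \<longleftrightarrow> sat N' (qs \<frown> flat k s' e) \<chi>))"
    if \<phi>: "wf_fm (slang M) \<phi>" for \<phi>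
  proof (intro exI conjI allI impI)
    define qs where "qs = map (\<lambda>p (g :: 'u \<Rightarrow> 'b). p) (ps \<phi>)"
    have qs: "set qs \<subseteq> B" using \<phi> by (auto simp: qs_def B_def params_def)
    show "wf_fm (slang N') (\<psi> \<phi>)" by (simp add: N' \<psi> \<phi>)
    show "set (map c qs) \<subseteq> carrier N'" using qs cB by auto
    fix e :: "nat \<Rightarrow> 'u" assume e: "range e \<subseteq> carrier M'"
    \<comment> \<open>Parameters followed by the coordinate functions of \<open>e\<close>: read at
      \<open>g\<close> this codes \<open>r \<circ> g \<circ> e\<close> by \<open>s\<close>, read
      through \<open>c\<close> it codes \<open>e\<close> by \<open>s'\<close>.\<close>
    define E where "E = qs \<frown> (\<lambda>j. coord (e (j div k)) (j mod k))"
    have "range E \<subseteq> B" using qs coord_B k unfolding E_def by auto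
    then have "sat N' (c \<circ> E) (\<psi> \<phi>) \<longleftrightarrow> eventually (\<lambda>g. sat N (\<lambda>x. E x g) (\<psi> \<phi>)) U"
      by (rule los[OF \<psi>[OF \<phi>]])
    moreover have "sat N (\<lambda>x. E x g) (\<psi> \<phi>) \<longleftrightarrow> sat M (r \<circ> g \<circ> e) \<phi>" for g
    proof -
      have "(\<lambda>x. E x g) = ps \<phi> \<frown> flat k s (r \<circ> g \<circ> e)"
        by (auto simp: E_def qs_def conc_def flat_def coord_def)
      moreover have "range (r \<circ> g \<circ> e) \<subseteq> carrier M" using r by auto
      ultimately show ?thesis using sat[OF \<phi>, of "r \<circ> g \<circ> e"] by (simp only:)
    qed
    moreover have "c \<circ> E = map c qs \<frown> flat k s' e"
      using k by (auto simp: E_def conc_def flat_def s'_def)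
    ultimately show "sat M' e \<phi> \<longleftrightarrow> sat N' (map c qs \<frown> flat k s' e) (\<psi> \<phi>)"
      using U[OF \<phi> e] by (simp only:)
  qed
  then have "formula_coding N' M' k s'"
    unfolding formula_coding_def lang using k s' by blast
  with N' holds show thesis by (rule that)
qed

text \<open>The coding is transferred rather than the trace definition, because it translates each
  formula uniformly in the assignment.\<close>

lemma trace_defines_equivalent:
  fixes N :: "('f, 'r, 'a) fo_struct" and M :: "('g, 's, 'b) fo_struct"
    and M' :: "('g, 's, 'u) fo_struct"
  assumes "is_structure N" "is_structure M" "is_structure M'" "slang M' = slang M"
    and "\<And>\<phi>. sentence (slang M) \<phi> \<Longrightarrow> holds M' \<phi> \<Longrightarrow> holds M \<phi>"
    and "interprets N M"
    and "adequate_universe TYPE('u) (slang N)" "adequate_universe TYPE('u) (slang M)"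
  obtains N' :: "('f, 'r, 'u) fo_struct" where "is_structure N'" "slang N' = slang N"
    "\<And>\<phi>. sentence (slang N) \<phi> \<Longrightarrow> holds N \<phi> \<Longrightarrow> holds N' \<phi>" "trace_defines N' M'"
proof -
  obtain k s where coding: "formula_coding N M k s"
    using interprets_imp_formula_coding assms(2,6) .
  obtain N' :: "('f, 'r, 'u) fo_struct" and s' where N': "is_structure N'" "slang N' = slang N"
    "\<And>\<phi>. wf_fm (slang N) \<phi> \<Longrightarrow> holds N \<phi> \<Longrightarrow> holds N' \<phi>" and "formula_coding N' M' k s'"
    using formula_coding_transfer[OF assms(1-5) coding assms(7,8)] by blast
  then have "trace_defines N' M'" by (intro formula_coding_imp_trace_defines)
  then show thesis using N' by (intro that[of N']) (auto simp: sentence_def)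
qed

section \<open>From structures to theories\<close>

lemma not_holds_Neg:
  assumes "is_structure M" "sentence L \<phi>" "holds M (Neg \<phi>)"
  shows "\<not> holds M \<phi>"
proof -
  obtain a where "a \<in> carrier M" using assms(1) unfolding is_structure_def by blast
  then have "range (\<lambda>_::nat. a) \<subseteq> carrier M" by auto
  then show ?thesis using assms(3) unfolding holds_def by auto
qed

lemma holds_or_holds_Neg:
  assumes "sentence L \<phi>"
  shows "holds M \<phi> \<or> holds M (Neg \<phi>)"
proof (rule disjCI)
  assume "\<not> holds M (Neg \<phi>)"
  then obtain e where "sat M e \<phi>" unfolding holds_def by auto
  then show "holds M \<phi>" by (rule sentence_sat_holds[OF assms])
qed

text \<open>Completeness makes \<open>M'\<close> equivalent to the interpreted model, and the
  structure found by transfer is a model of \<open>T\<close> because axioms are sentences.\<close>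

lemma theory_interprets_imp_trace_defines:
  fixes T :: "('f, 'r) fo_theory" and Tstar :: "('g, 's) fo_theory"
  assumes "adequate_universe TYPE('u) (tlang T)" "adequate_universe TYPE('u) (tlang Tstar)"
    and T: "complete_consistent TYPE('u) T" and Tstar: "complete_consistent TYPE('u) Tstar"
    and "theory_interprets TYPE('u) T Tstar"
  shows "theory_trace_defines TYPE('u) T Tstar"
  unfolding theory_trace_defines_def
proof (intro allI impI)
  fix M' :: "('g, 's, 'u) fo_struct" assume M': "is_model M' Tstar"
  obtain N :: "('f, 'r, 'u) fo_struct" and M :: "('g, 's, 'u) fo_struct"
    where N: "is_model N T" and M: "is_model M Tstar" and "interprets N M"
    using assms(5) unfolding theory_interprets_def by blast
  have equiv: "holds M \<phi>" if \<phi>: "sentence (slang M) \<phi>" and "holds M' \<phi>" for \<phi>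
  proof -
    have "\<not> holds M' (Neg \<phi>)"
      using not_holds_Neg[OF _ \<phi>, of M'] \<open>holds M' \<phi>\<close> M' unfolding is_model_def by blast
    then show ?thesis
      using Tstar M M' \<phi> unfolding complete_consistent_def is_model_def by metis
  qed
  obtain N' :: "('f, 'r, 'u) fo_struct" where N': "is_structure N'" "slang N' = slang N"
    "\<And>\<phi>. sentence (slang N) \<phi> \<Longrightarrow> holds N \<phi> \<Longrightarrow> holds N' \<phi>" and "trace_defines N' M'"
    using trace_defines_equivalent[of N M M'] equiv \<open>interprets N M\<close> assms(1,2) N M M'
    unfolding is_model_def by metis
  moreover have "is_model N' T"
    using N N' T unfolding is_model_def complete_consistent_def by metis
  ultimately show "theory_trace_defines_struct T M'"
    unfolding theory_trace_defines_struct_def by blast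
qed

text \<open>A structure decides each sentence, so a model of \<open>Th M\<close> satisfies no
  sentence that fails in \<open>M\<close>. The carriers of \<open>N\<close> and \<open>M\<close> may
  lie outside \<open>'u\<close>.\<close>

lemma interprets_imp_Th_trace_defines:
  fixes N :: "('f, 'r, 'a) fo_struct" and M :: "('g, 's, 'b) fo_struct"
  assumes univ: "adequate_universe TYPE('u) (slang N)" "adequate_universe TYPE('u) (slang M)"
    and N: "is_structure N" and M: "is_structure M" and "interprets N M"
  shows "theory_trace_defines TYPE('u) (Th N) (Th M)"
  unfolding theory_trace_defines_def
proof (intro allI impI)
  fix M' :: "('g, 's, 'u) fo_struct" assume "is_model M' (Th M)"
  then have M': "is_structure M'" "slang M' = slang M"
    and Th: "\<And>\<phi>. sentence (slang M) \<phi> \<Longrightarrow> holds M \<phi> \<Longrightarrow> holds M' \<phi>"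
    by (auto simp: is_model_def Th_def)
  have equiv: "holds M \<phi>" if \<phi>: "sentence (slang M) \<phi>" and "holds M' \<phi>" for \<phi>
  proof (rule ccontr)
    assume "\<not> holds M \<phi>"
    then have "holds M (Neg \<phi>)" using holds_or_holds_Neg[OF \<phi>] by blast
    then have "holds M' (Neg \<phi>)" using \<phi> by (intro Th) (simp_all add: sentence_def)
    then show False using not_holds_Neg[OF M'(1) \<phi>] \<open>holds M' \<phi>\<close> by blast
  qed
  obtain N' :: "('f, 'r, 'u) fo_struct" where "is_structure N'" "slang N' = slang N"
    "\<And>\<phi>. sentence (slang N) \<phi> \<Longrightarrow> holds N \<phi> \<Longrightarrow> holds N' \<phi>" "trace_defines N' M'"
    using trace_defines_equivalent[OF N M M' equiv \<open>interprets N M\<close> univ] by blast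
  then show "theory_trace_defines_struct (Th N) M'"
    unfolding theory_trace_defines_struct_def by (auto simp: is_model_def Th_def)
qed

theorem proposition1p4:
  fixes N :: "('f, 'r, 'a) fo_struct"
    and M :: "('g, 's, 'b) fo_struct"
    and T :: "('f, 'r) fo_theory"
    and Tstar :: "('g, 's) fo_theory"
  shows "(is_structure N \<and> is_structure M \<and> interprets N M \<longrightarrow> trace_defines N M) \<and>
    (adequate_universe TYPE('u) (tlang T) \<and> adequate_universe TYPE('u) (tlang Tstar) \<and>
      complete_consistent TYPE('u) T \<and> complete_consistent TYPE('u) Tstar \<and>
      theory_interprets TYPE('u) T Tstar \<longrightarrow> theory_trace_defines TYPE('u) T Tstar) \<and>
    (adequate_universe TYPE('u) (slang N) \<and> adequate_universe TYPE('u) (slang M) \<and>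
      is_structure N \<and> is_structure M \<and>
      mutually_interpretable N M \<longrightarrow> trace_equivalent TYPE('u) N M) \<and>
    (adequate_universe TYPE('u) (tlang T) \<and> adequate_universe TYPE('u) (tlang Tstar) \<and>
      complete_consistent TYPE('u) T \<and> complete_consistent TYPE('u) Tstar \<and>
      mutually_interpretable_theories TYPE('u) T Tstar \<longrightarrow>
      trace_equivalent_theories TYPE('u) T Tstar)"
proof (intro conjI impI; elim conjE)
  assume "is_structure M" "interprets N M"
  then show "trace_defines N M"
    by (metis interprets_imp_formula_coding formula_coding_imp_trace_defines)
\<comment> \<open>The remaining claims apply the two lemmas on theories, in both directions for the
  mutual versions.\<close>
qed (simp_all add: theory_interprets_imp_trace_defines interprets_imp_Th_trace_defines
    mutually_interpretable_def trace_equivalent_def trace_equivalent_theories_def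
    mutually_interpretable_theories_def)

end
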